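(* Let $\alpha\in[0,1)$, let $\mathbb{T}$ be an unbounded time scale with $0\in\mathbb{T}$, let $\lambda\in\mathbb{R}$, $u:\mathbb{T}\to\mathbb{R}$, $x_0\in\mathbb{R}$, and suppose $K(\alpha):=1-\lambda(1-\alpha)\neq 0$. Then the equation $$\left({}^{CF}\Delta_t^{(\alpha)}x\right)(t)=\lambda x(t)+u(t),\qquad t\in\mathbb{T},$$ subject to the initial condition $x(0)=x_0$, has the unique solution $$x(t)=x(0)-\frac{1}{K(\alpha)}\left(1-e_{p(\alpha)}(t,0)\right)x(0)+\frac{1-\alpha}{K(\alpha)}\,(u(t)-u(0))+\frac{\alpha}{K^2(\alpha)}\int_0^t e_{p(\alpha)}(t,\sigma(\tau))\,u(\tau)\,\Delta\tau,$$ where $p(\alpha)=\frac{\lambda\alpha}{K(\alpha)}$.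
   Context: A time scale $\mathbb{T}$ is a nonempty closed subset of $\mathbb{R}$; $\sigma(t)=\inf\{s\in\mathbb{T}:s>t\}$ is the forward jump operator, $\mu(t)=\sigma(t)-t$ the graininess, $f^\Delta$ the delta derivative, and $\int\cdot\,\Delta\tau$ the delta integral (standard time scale calculus). A function $p:\mathbb{T}\to\mathbb{R}$ is regressive if $1+\mu(t)p(t)\neq 0$ for all $t$. For regressive rd-continuous $p$, the time scale exponential $e_p(\cdot,s)$ is the unique solution of $y^\Delta(t)=p(t)y(t)$, $y(s)=1$; expressions $e_p$ presuppose that $p$ is regressive. For $\alpha\in[0,1)$ put $\bar\alpha=\frac{\alpha}{\alpha-1}$. The (left-sided) Caputo--Fabrizio fractional delta derivative of order $\alpha$ started at $0$ (with normalization $M(\alpha)=1$) is $$\left({}^{CF}\Delta_t^{(\alpha)}f\right)(t)=\frac{1}{1-\alpha}\int_0^t f^\Delta(\tau)\,e_{\bar\alpha}(t,\sigma(\tau))\,\Delta\tau .$$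
   Formalization: Existence fails for arbitrary u and x_0 (at t=0 the equation forces λx_0+u(0)=0); the formal theorem proves that any solution equals the displayed formula, and that the formula is a solution exactly when u is delta differentiable and λx_0+u(0)=0. *)

theory Defs
  imports "HOL-Analysis.Analysis"
begin

definition time_scale :: "real set \<Rightarrow> bool" where
  "time_scale T \<longleftrightarrow> T \<noteq> {} \<and> closed T"

text \<open>Usual conventions \<open>inf {} = sup T\<close> in the forward and \<open>sup {} = inf T\<close> in the backward
  jump: a maximum, respectively minimum, of \<open>T\<close> is mapped to itself.\<close>

definition fwd_jump :: "real set \<Rightarrow> real \<Rightarrow> real" where
  "fwd_jump T t = (if {s\<in>T. s > t} = {} then t else Inf {s\<in>T. s > t})"

definition bwd_jump :: "real set \<Rightarrow> real \<Rightarrow> real" where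
  "bwd_jump T t = (if {s\<in>T. s < t} = {} then t else Sup {s\<in>T. s < t})"

definition graininess :: "real set \<Rightarrow> real \<Rightarrow> real" where
  "graininess T t = fwd_jump T t - t"

text \<open>The set usually written \<open>T\<close> with superscript kappa: \<open>T\<close> without its maximum, if there is
  one and it is left-scattered. Delta derivatives are only considered at these points (at a
  left-scattered maximum every number would be a delta derivative).\<close>

definition ts_kappa :: "real set \<Rightarrow> real set" where
  "ts_kappa T = {t\<in>T. \<not> ((\<forall>s\<in>T. s \<le> t) \<and> bwd_jump T t < t)}"

definition has_delta_derivative :: "real set \<Rightarrow> (real \<Rightarrow> real) \<Rightarrow> real \<Rightarrow> real \<Rightarrow> bool" where
  "has_delta_derivative T f D t \<longleftrightarrow>
     (\<forall>\<epsilon>>0. \<exists>\<delta>>0. \<forall>s\<in>T. \<bar>s - t\<bar> < \<delta> \<longrightarrow>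
        \<bar>(f (fwd_jump T t) - f s) - D * (fwd_jump T t - s)\<bar> \<le> \<epsilon> * \<bar>fwd_jump T t - s\<bar>)"

definition delta_differentiable :: "real set \<Rightarrow> (real \<Rightarrow> real) \<Rightarrow> bool" where
  "delta_differentiable T f \<longleftrightarrow> (\<forall>t\<in>ts_kappa T. \<exists>D. has_delta_derivative T f D t)"

definition delta_deriv :: "real set \<Rightarrow> (real \<Rightarrow> real) \<Rightarrow> real \<Rightarrow> real" where
  "delta_deriv T f t = (THE D. has_delta_derivative T f D t)"

definition delta_antiderivative :: "real set \<Rightarrow> (real \<Rightarrow> real) \<Rightarrow> (real \<Rightarrow> real) \<Rightarrow> bool" where
  "delta_antiderivative T F f \<longleftrightarrow> (\<forall>t\<in>ts_kappa T. has_delta_derivative T F (f t) t)"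

definition delta_integrable :: "real set \<Rightarrow> (real \<Rightarrow> real) \<Rightarrow> bool" where
  "delta_integrable T f \<longleftrightarrow> (\<exists>F. delta_antiderivative T F f)"

text \<open>The (Cauchy) delta integral from \<open>a\<close> to \<open>b\<close>, i.e. \<open>F b - F a\<close> for any antiderivative \<open>F\<close>;
  antiderivatives agree on \<open>T\<close> up to a constant, and every rd-continuous function has one.
  The endpoints may be in either order. The value is junk if \<open>f\<close> is not \<open>delta_integrable\<close>.\<close>

definition delta_integral :: "real set \<Rightarrow> real \<Rightarrow> real \<Rightarrow> (real \<Rightarrow> real) \<Rightarrow> real" where
  "delta_integral T a b f = (THE I. \<exists>F. delta_antiderivative T F f \<and> I = F b - F a)"

definition regressive :: "real set \<Rightarrow> (real \<Rightarrow> real) \<Rightarrow> bool" where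
  "regressive T p \<longleftrightarrow> (\<forall>t\<in>T. 1 + graininess T t * p t \<noteq> 0)"

text \<open>\<open>ts_exp T p t s\<close> is the value at \<open>t\<close> of the solution \<open>y\<close> on \<open>T\<close> of the initial value problem
  with delta derivative \<open>p * y\<close> and \<open>y s = 1\<close>. Only the values of \<open>y\<close> on \<open>T\<close> are determined by the
  problem, so the description operator is applied to the value and not to the function.\<close>

definition ts_exp :: "real set \<Rightarrow> (real \<Rightarrow> real) \<Rightarrow> real \<Rightarrow> real \<Rightarrow> real" where
  "ts_exp T p t s =
     (THE v. \<exists>y. (\<forall>\<tau>\<in>ts_kappa T. has_delta_derivative T y (p \<tau> * y \<tau>) \<tau>) \<and> y s = 1 \<and> v = y t)"

definition cf_rate :: "real \<Rightarrow> real" where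
  "cf_rate \<alpha> = \<alpha> / (\<alpha> - 1)"

definition cf_integrand :: "real set \<Rightarrow> real \<Rightarrow> (real \<Rightarrow> real) \<Rightarrow> real \<Rightarrow> real \<Rightarrow> real" where
  "cf_integrand T \<alpha> f t \<tau> = delta_deriv T f \<tau> * ts_exp T (\<lambda>_. cf_rate \<alpha>) t (fwd_jump T \<tau>)"

text \<open>Left-sided Caputo--Fabrizio derivative of order \<open>\<alpha>\<close> with base point \<open>0\<close> and normalization
  \<open>M(\<alpha>) = 1\<close>; \<open>t\<close> may also be negative.\<close>

definition cf_deriv :: "real set \<Rightarrow> real \<Rightarrow> (real \<Rightarrow> real) \<Rightarrow> real \<Rightarrow> real" where
  "cf_deriv T \<alpha> f t = 1 / (1 - \<alpha>) * delta_integral T 0 t (cf_integrand T \<alpha> f t)"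

text \<open>The expression \<open>cf_deriv T \<alpha> f t\<close> is meaningful for all \<open>t\<close> in \<open>T\<close>.\<close>

definition cf_differentiable :: "real set \<Rightarrow> real \<Rightarrow> (real \<Rightarrow> real) \<Rightarrow> bool" where
  "cf_differentiable T \<alpha> f \<longleftrightarrow>
     delta_differentiable T f \<and> (\<forall>t\<in>T. delta_integrable T (cf_integrand T \<alpha> f t))"

definition cf_solution ::
  "real set \<Rightarrow> real \<Rightarrow> real \<Rightarrow> (real \<Rightarrow> real) \<Rightarrow> real \<Rightarrow> (real \<Rightarrow> real) \<Rightarrow> bool" where
  "cf_solution T \<alpha> lam u x0 x \<longleftrightarrow>
     cf_differentiable T \<alpha> x \<and> (\<forall>t\<in>T. cf_deriv T \<alpha> x t = lam * x t + u t) \<and> x 0 = x0"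

end

theory Submission
  imports Defs
begin

text \<open>Put \<open>q = \<alpha> / (\<alpha> - 1)\<close> and \<open>m = (1 - \<alpha>) * cf_deriv T \<alpha> x\<close>. Since \<open>m\<close> is a convolution with
  the exponential of rate \<open>q\<close>, it is the solution of \<open>m\<^sup>\<Delta> = q m + x\<^sup>\<Delta>\<close>, \<open>m 0 = 0\<close>. Inserting
  \<open>m = (1 - \<alpha>) (\<lambda> x + u)\<close> forces \<open>u\<close> to be differentiable with \<open>\<lambda> x\<^sub>0 + u 0 = 0\<close>, and
  \<open>z = x - (1 - \<alpha>) / K * u\<close> then satisfies \<open>z\<^sup>\<Delta> = p z + \<alpha> / K\<^sup>2 * u\<close>, which variation of
  constants solves. All steps are reversible. The analytic input is that rd-continuous functions
  have antiderivatives, that these are unique up to constants, and that regressive constants have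
  nonvanishing exponentials.\<close>

text \<open>The kernel of the derivative splits: for a nowhere vanishing solution \<open>d\<close>
  of the linear equation with rate \<open>q\<close>, the exponential from
  \<open>\<sigma> \<tau>\<close> to \<open>t\<close> is \<open>d t / d (\<sigma> \<tau>)\<close>.
  Hence the integrals for all \<open>t\<close> come from one antiderivative. Since
  \<open>q * (1 - \<alpha>) = - \<alpha>\<close>, the equation for \<open>m\<close> becomes K x' =
  \<alpha> (\<lambda> x + u) + (1 - \<alpha>) u'. Subtracting (1 - \<alpha>) / K u from x absorbs
  u'. Expressing x through z then changes the coefficient \<alpha> / K of u into \<alpha> / K
  (\<lambda> (1 - \<alpha>) / K + 1) = \<alpha> / K^2; this is where the square comes from. Two
  obstacles shape the rest. A regressive rate may make 1 + \<mu> p negative, so an exponential can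
  change sign across a gap and its logarithm is not at hand. And the integrands are in general
  discontinuous at points that are left-dense and right-scattered, so their antiderivatives cannot
  be taken from the continuous theory directly.\<close>

lemma isCont_ln_div: "isCont (\<lambda>m. if m = 0 then p else ln (1 + m * p) / m) (0::real)"
proof -
  have "((\<lambda>m. ln (1 + m * p)) has_real_derivative p) (at 0)"
    by (auto intro!: derivative_eq_intros)
  then have "((\<lambda>m. ln (1 + m * p) / m) \<longlongrightarrow> p) (at 0)"
    by (simp add: has_field_derivative_iff)
  then have "((\<lambda>m. if m = 0 then p else ln (1 + m * p) / m) \<longlongrightarrow> p) (at 0)"
    by (rule Lim_transform_eventually) (auto simp: eventually_at_filter)
  then show ?thesis by (simp add: isCont_def)
qed

text \<open>A rate of \<open>pi / m\<close> over a gap of length \<open>m\<close> adds a phase of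
  \<open>pi\<close>, that is, one change of sign. Near \<open>m = 0\<close> the factor
  \<open>1 + m * p\<close> is positive, so the function is locally zero there.\<close>

lemma isCont_neg_jump: "isCont (\<lambda>m. if 1 + m * p < 0 then pi / m else 0) (0::real)"
proof -
  have "((\<lambda>m. 1 + m * p) \<longlongrightarrow> 1 + 0 * p) (at 0)" by (intro tendsto_intros)
  then have "\<forall>\<^sub>F m in at 0. 1 + m * p > 0" by (intro order_tendstoD(1)) auto
  then have "((\<lambda>m. if 1 + m * p < 0 then pi / m else 0) \<longlongrightarrow> 0) (at 0)"
    by (intro tendsto_eventually) (auto elim!: eventually_mono)
  then show ?thesis by (simp add: isCont_def)
qed

section \<open>Order and continuity properties of the forward jump\<close>

locale timescale =
  fixes T :: "real set"
  assumes ts: "time_scale T"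
begin

abbreviation \<sigma> :: "real \<Rightarrow> real" where "\<sigma> \<equiv> fwd_jump T"

lemma closed_T: "closed T" and T_nonempty: "T \<noteq> {}"
  using ts by (auto simp: time_scale_def)

lemma fwd_jump_le: "s \<in> T \<Longrightarrow> r < s \<Longrightarrow> \<sigma> r \<le> s"
  unfolding fwd_jump_def by (auto intro!: cInf_lower bdd_belowI[of _ r])

lemma fwd_jump_ge: "r \<le> \<sigma> r"
  unfolding fwd_jump_def by (auto intro!: cInf_greatest)

lemma fwd_jump_eq_Inf: "{s \<in> T. s > t} \<noteq> {} \<Longrightarrow> \<sigma> t = Inf {s \<in> T. s > t}"
  unfolding fwd_jump_def by (rule if_not_P)

lemma fwd_jump_in: assumes "t \<in> T" shows "\<sigma> t \<in> T"
proof (cases "{s \<in> T. s > t} = {}")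
  case False
  have "Inf {s \<in> T. s > t} \<in> T"
    by (rule closed_subset_contains_Inf[OF closed_T])
       (use False in \<open>auto intro!: bdd_belowI[of _ t]\<close>)
  with fwd_jump_eq_Inf[OF False] show ?thesis by simp
next
  case True
  then show ?thesis using assms unfolding fwd_jump_def by simp
qed

lemma mono_fwd_jump: "mono \<sigma>"
proof (rule monoI)
  fix r s :: real assume "r \<le> s"
  show "\<sigma> r \<le> \<sigma> s"
  proof (cases "{q \<in> T. q > s} = {}")
    case True
    then have *: "\<sigma> s = s" by (simp add: fwd_jump_def)
    show ?thesis
    proof (cases "{q \<in> T. q > r} = {}")
      case True then show ?thesis using * \<open>r \<le> s\<close> by (simp add: fwd_jump_def)
    next
      case False
      then obtain q where "q \<in> T" "q > r" by auto
      moreover have "q \<le> s" using True \<open>q \<in> T\<close> by force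
      ultimately show ?thesis using fwd_jump_le[of q r] * by simp
    qed
  next
    case False
    then have "\<sigma> s = Inf {q \<in> T. q > s}" by (rule fwd_jump_eq_Inf)
    also have "\<sigma> r \<le> \<dots>"
      by (rule cInf_greatest) (use False \<open>r \<le> s\<close> in \<open>auto intro!: fwd_jump_le\<close>)
    finally show ?thesis .
  qed
qed

text \<open>A maximum of \<open>T\<close> also satisfies \<open>\<sigma> t = t\<close>, by the
  convention for the empty infimum; the third premise excludes it.\<close>

lemma right_dense_approx:
  assumes "t \<in> T" "\<sigma> t = t" "\<exists>s\<in>T. s > t" "\<delta> > 0"
  obtains s where "s \<in> T" "t < s" "s < t + \<delta>"
proof (rule ccontr)
  assume neg: "\<not> thesis"
  have ne: "{s \<in> T. s > t} \<noteq> {}" using assms by auto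
  have "t + \<delta> \<le> Inf {s \<in> T. s > t}"
    by (rule cInf_greatest[OF ne]) (use neg that in force)
  then show False using fwd_jump_eq_Inf[OF ne] assms by simp
qed

text \<open>A point \<open>s\<close> of \<open>T\<close> slightly to the right of \<open>t\<close>
  caps \<open>\<sigma> x\<close> for every \<open>x < s\<close>; at a maximum, monotonicity gives
  the cap \<open>t\<close> instead. From below, \<open>x \<le> \<sigma> x\<close> suffices.\<close>

lemma continuous_fwd_jump:
  assumes "t \<in> T" "\<sigma> t = t"
  shows "continuous (at t within T) \<sigma>"
  unfolding continuous_within_eps_delta
proof (intro allI impI)
  fix e :: real assume "e > 0"
  show "\<exists>d>0. \<forall>x'\<in>T. dist x' t < d \<longrightarrow> dist (\<sigma> x') (\<sigma> t) < e"
  proof (cases "\<exists>s\<in>T. s > t")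
    case True
    then obtain s where s: "s \<in> T" "t < s" "s < t + e"
      using right_dense_approx[OF assms] \<open>e > 0\<close> by metis
    show ?thesis
    proof (intro exI[of _ "min e (s - t)"] conjI ballI impI)
      fix x assume x: "x \<in> T" "dist x t < min e (s - t)"
      then have "\<sigma> x \<le> s" using s by (intro fwd_jump_le) (auto simp: dist_real_def)
      then show "dist (\<sigma> x) (\<sigma> t) < e"
        using s x assms fwd_jump_ge[of x] by (auto simp: dist_real_def)
    qed (use s \<open>e > 0\<close> in auto)
  next
    case False
    show ?thesis
    proof (intro exI[of _ e] conjI ballI impI)
      fix x assume x: "x \<in> T" "dist x t < e"
      have "\<sigma> x \<le> t" using False monoD[OF mono_fwd_jump, of x t] x(1) assms by force
      then show "dist (\<sigma> x) (\<sigma> t) < e"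
        using x assms fwd_jump_ge[of x] by (auto simp: dist_real_def)
    qed fact
  qed
qed

subsection \<open>Delta derivatives\<close>

text \<open>At a right-scattered point \<open>\<bar>\<sigma> t - s\<bar>\<close> stays away from
  zero as \<open>s\<close> tends to \<open>t\<close>, so the defining estimate says no more than
  continuity together with an exact difference quotient across the gap. The calculus rules below
  reduce to these two cases.\<close>

lemma has_delta_derivative_iff:
  assumes "t \<in> T"
  shows "has_delta_derivative T f D t \<longleftrightarrow>
    (if \<sigma> t = t then (f has_real_derivative D) (at t within T)
     else continuous (at t within T) f \<and> f (\<sigma> t) = f t + D * graininess T t)"
proof (cases "\<sigma> t = t")
  case True
  have *: "\<bar>(f t - f s) - D * (t - s)\<bar> = \<bar>f s - f t - D * (s - t)\<bar>" for s
    by (simp add: algebra_simps)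
  show ?thesis
    unfolding has_delta_derivative_def has_field_derivative_def has_derivative_within_alt True *
    by (simp add: abs_minus_commute bounded_linear_mult_right)
next
  case False
  then have gt: "\<sigma> t > t" using fwd_jump_ge[of t] by simp
  let ?m = "\<sigma> t - t"
  have iff: "has_delta_derivative T f D t \<longleftrightarrow> continuous (at t within T) f \<and> f (\<sigma> t) = f t + D * ?m"
  proof (intro iffI conjI)
    assume L: "has_delta_derivative T f D t"
    have "\<bar>f (\<sigma> t) - f t - D * ?m\<bar> \<le> 0 + e" if "e > 0" for e
    proof -
      have "e / ?m > 0" using that gt by simp
      then obtain d where "d > 0" and d: "\<And>s. s \<in> T \<Longrightarrow> \<bar>s - t\<bar> < d \<Longrightarrow>
          \<bar>(f (\<sigma> t) - f s) - D * (\<sigma> t - s)\<bar> \<le> e / ?m * \<bar>\<sigma> t - s\<bar>"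
        using L unfolding has_delta_derivative_def by meson
      from d[of t] \<open>d > 0\<close> assms gt show ?thesis by simp
    qed
    then have "\<bar>f (\<sigma> t) - f t - D * ?m\<bar> \<le> 0" by (rule field_le_epsilon)
    then show jump: "f (\<sigma> t) = f t + D * ?m" by simp
    show "continuous (at t within T) f"
      unfolding continuous_within_eps_delta
    proof (intro allI impI)
      fix e :: real assume "e > 0"
      \<comment> \<open>With this tolerance the gap contributes \<open>c * ?m = e / 2\<close>; the
        second bound in \<open>d'\<close> makes the part proportional to
        \<open>\<bar>s - t\<bar>\<close> smaller than the other half.\<close>
      define c where "c = e / (2 * ?m)"
      have "c > 0" using \<open>e > 0\<close> gt by (simp add: c_def)
      then obtain d where "d > 0" and d: "\<And>s. s \<in> T \<Longrightarrow> \<bar>s - t\<bar> < d \<Longrightarrow>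
          \<bar>(f (\<sigma> t) - f s) - D * (\<sigma> t - s)\<bar> \<le> c * \<bar>\<sigma> t - s\<bar>"
        using L unfolding has_delta_derivative_def by meson
      define d' where "d' = min d (e / (2 * (\<bar>D\<bar> + c + 1)))"
      have "d' > 0" using \<open>d > 0\<close> \<open>e > 0\<close> \<open>c > 0\<close> by (simp add: d'_def add_pos_pos)
      have "\<bar>f s - f t\<bar> < e" if s: "s \<in> T" "\<bar>s - t\<bar> < d'" for s
      proof -
        have "\<bar>(f t - f s) - D * (t - s)\<bar> \<le> c * \<bar>\<sigma> t - s\<bar>"
          using d[of s] s jump by (simp add: d'_def algebra_simps)
        also have "\<dots> \<le> c * (?m + \<bar>s - t\<bar>)"
          using \<open>c > 0\<close> gt by (intro mult_left_mono) auto
        also have "\<dots> = e / 2 + c * \<bar>s - t\<bar>"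
          using gt by (simp add: c_def field_simps)
        finally have "\<bar>f s - f t\<bar> \<le> e / 2 + (\<bar>D\<bar> + c) * \<bar>s - t\<bar>"
          using abs_triangle_ineq[of "(f t - f s) - D * (t - s)" "D * (t - s)"]
          by (simp add: abs_mult abs_minus_commute[of t s] abs_minus_commute[of "f t" "f s"] distrib_right)
        also have "\<dots> < e / 2 + e / 2"
        proof -
          have "(\<bar>D\<bar> + c) * \<bar>s - t\<bar> \<le> (\<bar>D\<bar> + c + 1) * \<bar>s - t\<bar>" by (intro mult_right_mono) auto
          also have "\<dots> < (\<bar>D\<bar> + c + 1) * (e / (2 * (\<bar>D\<bar> + c + 1)))"
            using s \<open>c > 0\<close> by (intro mult_strict_left_mono) (auto simp: d'_def)
          also have "\<dots> = e / 2"
          proof -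
            have "\<bar>D\<bar> + c + 1 \<noteq> 0" using \<open>c > 0\<close> by linarith
            moreover have "x * (e / (2 * x)) = e / 2" if "x \<noteq> 0" for x
              using that by simp
            ultimately show ?thesis by blast
          qed
          finally show ?thesis by simp
        qed
        finally show ?thesis by simp
      qed
      with \<open>d' > 0\<close> show "\<exists>d>0. \<forall>x'\<in>T. dist x' t < d \<longrightarrow> dist (f x') (f t) < e"
        by (auto simp: dist_real_def)
    qed
  next
    assume R: "continuous (at t within T) f \<and> f (\<sigma> t) = f t + D * ?m"
    show "has_delta_derivative T f D t"
      unfolding has_delta_derivative_def
    proof (intro allI impI)
      fix e :: real assume "e > 0"
      have "continuous (at t within T) (\<lambda>s. f s - D * s)"
        using R by (intro continuous_intros) auto
      moreover have "e * ?m > 0" using \<open>e > 0\<close> gt by simp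
      ultimately obtain d where "d > 0" and d: "\<And>s. s \<in> T \<Longrightarrow> \<bar>s - t\<bar> < d \<Longrightarrow>
          \<bar>(f s - D * s) - (f t - D * t)\<bar> < e * ?m"
        unfolding continuous_within_eps_delta dist_real_def by meson
      show "\<exists>d>0. \<forall>s\<in>T. \<bar>s - t\<bar> < d \<longrightarrow>
          \<bar>f (\<sigma> t) - f s - D * (\<sigma> t - s)\<bar> \<le> e * \<bar>\<sigma> t - s\<bar>"
      proof (intro exI[of _ "min d ?m"] conjI ballI impI)
        fix s assume s: "s \<in> T" "\<bar>s - t\<bar> < min d ?m"
        \<comment> \<open>A point closer to \<open>t\<close> than the length of the gap cannot lie
          to its right, so \<open>\<bar>\<sigma> t - s\<bar>\<close> is at least
          \<open>?m\<close>.\<close>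
        then have "s \<le> t" using fwd_jump_le[of s t] by force
        have "f (\<sigma> t) - f s - D * (\<sigma> t - s) = - ((f s - D * s) - (f t - D * t))"
          using R by (simp add: algebra_simps)
        then have "\<bar>f (\<sigma> t) - f s - D * (\<sigma> t - s)\<bar> = \<bar>(f s - D * s) - (f t - D * t)\<bar>"
          by (simp only: abs_minus_cancel)
        also have "\<dots> \<le> e * ?m" using d[of s] s by simp
        also have "\<dots> \<le> e * \<bar>\<sigma> t - s\<bar>" using \<open>s \<le> t\<close> \<open>e > 0\<close> gt by (intro mult_left_mono) auto
        finally show "\<bar>f (\<sigma> t) - f s - D * (\<sigma> t - s)\<bar> \<le> e * \<bar>\<sigma> t - s\<bar>" .
      qed (use \<open>d > 0\<close> gt in auto)
    qed
  qed
  then show ?thesis using False by (simp add: graininess_def)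
qed

lemma kappa_in: "t \<in> ts_kappa T \<Longrightarrow> t \<in> T"
  by (simp add: ts_kappa_def)

lemma kappa_not_max: "t \<in> T \<Longrightarrow> s \<in> T \<Longrightarrow> t < s \<Longrightarrow> t \<in> ts_kappa T"
  by (force simp: ts_kappa_def)

lemma delta_derivative_continuous:
  assumes "has_delta_derivative T f D t" "t \<in> T"
  shows "continuous (at t within T) f"
  using assms by (auto simp: has_delta_derivative_iff DERIV_continuous split: if_splits)

lemma delta_derivative_jump:
  assumes "has_delta_derivative T f D t" "t \<in> T"
  shows "f (\<sigma> t) = f t + D * graininess T t"
  using assms by (auto simp: has_delta_derivative_iff graininess_def split: if_splits)

lemma bwd_jump_approx:
  assumes "s \<in> T" "s < t" "\<not> bwd_jump T t < t" "d > 0"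
  obtains q where "q \<in> T" "q < t" "t - d < q"
proof (rule ccontr)
  assume neg: "\<not> thesis"
  have ne: "{q \<in> T. q < t} \<noteq> {}" using assms by auto
  have "Sup {q \<in> T. q < t} \<le> t - d"
    by (rule cSup_least[OF ne]) (use neg that in force)
  then show False using ne assms by (simp add: bwd_jump_def split: if_splits)
qed

text \<open>This is what makes delta derivatives unique at right-dense points; a maximum in
  \<open>ts_kappa\<close> is approached from the left. The point of a one-point time scale is fixed
  by both jumps and hence in \<open>ts_kappa\<close>, yet isolated, which explains the last
  premise.\<close>

lemma kappa_limpt:
  assumes "t \<in> ts_kappa T" "\<sigma> t = t" "T \<noteq> {t}"
  shows "t islimpt T"
  unfolding islimpt_approachable
proof (intro allI impI)
  fix e :: real assume "e > 0"
  have t: "t \<in> T" using assms kappa_in by simp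
  show "\<exists>x'\<in>T. x' \<noteq> t \<and> dist x' t < e"
  proof (cases "\<exists>s\<in>T. s > t")
    case True
    then obtain s where "s \<in> T" "t < s" "s < t + e"
      using right_dense_approx[OF t assms(2)] \<open>e > 0\<close> by metis
    then show ?thesis by (auto simp: dist_real_def intro!: bexI[of _ s])
  next
    case False
    then have max: "\<forall>s\<in>T. s \<le> t" by force
    then have "\<not> bwd_jump T t < t" using assms by (simp add: ts_kappa_def)
    moreover obtain s where "s \<in> T" "s < t" using assms t max by force
    ultimately obtain q where "q \<in> T" "q < t" "t - e < q"
      using bwd_jump_approx \<open>e > 0\<close> by metis
    then show ?thesis by (auto simp: dist_real_def intro!: bexI[of _ q])
  qed
qed

lemma delta_derivative_unique:
  assumes "has_delta_derivative T f D t" "has_delta_derivative T f D' t"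
    and "t \<in> ts_kappa T" "T \<noteq> {t}"
  shows "D = D'"
proof (cases "\<sigma> t = t")
  case True
  have "at t within T \<noteq> bot"
    using kappa_limpt[OF assms(3) True assms(4)] trivial_limit_within by blast
  moreover have "(f has_real_derivative D) (at t within T)" "(f has_real_derivative D') (at t within T)"
    using assms True kappa_in by (simp_all add: has_delta_derivative_iff)
  ultimately show ?thesis
    by (auto simp: has_field_derivative_iff intro: tendsto_unique)
next
  case False
  then have "graininess T t \<noteq> 0" by (simp add: graininess_def)
  moreover have "D * graininess T t = D' * graininess T t"
    using assms delta_derivative_jump kappa_in by (metis add_left_imp_eq)
  ultimately show ?thesis by simp
qed

lemma delta_deriv_eq:
  assumes "has_delta_derivative T f D t" "t \<in> ts_kappa T" "T \<noteq> {t}"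
  shows "delta_deriv T f t = D"
  unfolding delta_deriv_def using assms by (blast intro: delta_derivative_unique the_equality)

lemma has_delta_derivative_cong:
  assumes "\<And>s. s \<in> T \<Longrightarrow> f s = g s" "t \<in> T"
  shows "has_delta_derivative T f D t \<longleftrightarrow> has_delta_derivative T g D t"
  using assms fwd_jump_in by (simp add: has_delta_derivative_def)

lemma has_delta_derivative_const: "t \<in> T \<Longrightarrow> has_delta_derivative T (\<lambda>_. c) 0 t"
  by (auto simp: has_delta_derivative_def intro: exI[of _ 1])

lemma has_delta_derivative_add:
  assumes "has_delta_derivative T f D t" "has_delta_derivative T g E t" "t \<in> T"
  shows "has_delta_derivative T (\<lambda>s. f s + g s) (D + E) t"
  using assms
  by (auto simp: has_delta_derivative_iff algebra_simps intro!: DERIV_add continuous_intros split: if_splits)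

lemma has_delta_derivative_cmult:
  assumes "has_delta_derivative T f D t" "t \<in> T"
  shows "has_delta_derivative T (\<lambda>s. c * f s) (c * D) t"
  using assms
  by (auto simp: has_delta_derivative_iff distrib_left intro!: DERIV_cmult continuous_intros split: if_splits)

lemma has_delta_derivative_diff:
  assumes "has_delta_derivative T f D t" "has_delta_derivative T g E t" "t \<in> T"
  shows "has_delta_derivative T (\<lambda>s. f s - g s) (D - E) t"
  using has_delta_derivative_add[OF assms(1) has_delta_derivative_cmult[OF assms(2,3), of "-1"] assms(3)]
  by simp

text \<open>Of the two forms of the product rule, the one with the first factor at
  \<open>\<sigma> t\<close> suits the factors \<open>1 / e\<close> used later: it leaves
  \<open>e (\<sigma> t)\<close> in the denominator, as in the convolution kernel.\<close>

lemma has_delta_derivative_mult: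
  assumes "has_delta_derivative T f D t" "has_delta_derivative T g E t" "t \<in> T"
  shows "has_delta_derivative T (\<lambda>s. f s * g s) (D * g t + f (\<sigma> t) * E) t"
proof (cases "\<sigma> t = t")
  case True
  then show ?thesis using assms DERIV_mult'[of f D t T g E]
    by (simp add: has_delta_derivative_iff algebra_simps)
next
  case False
  then show ?thesis using assms
    by (auto simp: has_delta_derivative_iff algebra_simps intro!: continuous_intros)
qed

lemma has_delta_derivative_inverse:
  assumes "has_delta_derivative T f D t" "f t \<noteq> 0" "f (\<sigma> t) \<noteq> 0" "t \<in> T"
  shows "has_delta_derivative T (\<lambda>s. 1 / f s) (- D / (f t * f (\<sigma> t))) t"
proof (cases "\<sigma> t = t")
  case True
  have "((\<lambda>s. 1 / f s) has_real_derivative - (D / (f t * f t))) (at t within T)"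
    using DERIV_divide[OF DERIV_const, of f D t T 1] assms True by (simp add: has_delta_derivative_iff)
  then show ?thesis using assms True by (simp add: has_delta_derivative_iff)
next
  case False
  have "1 / f (\<sigma> t) = 1 / f t - D * graininess T t / (f t * f (\<sigma> t))"
  proof -
    have "1 / a = 1 / b - (a - b) / (b * a)" if "a \<noteq> 0" "b \<noteq> 0" for a b :: real
      using that by (simp add: field_simps)
    from this[of "f (\<sigma> t)" "f t"] show ?thesis
      using assms delta_derivative_jump[OF assms(1,4)] by simp
  qed
  then show ?thesis using assms False delta_derivative_continuous[OF assms(1,4)]
    by (auto simp: has_delta_derivative_iff intro!: continuous_intros)
qed

section \<open>Continuity and constancy from delta derivatives\<close>

lemma continuous_within_kappa_imp:
  assumes "\<And>t. t \<in> ts_kappa T \<Longrightarrow> continuous (at t within T) f"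
  shows "continuous_on T f"
  unfolding continuous_on_eq_continuous_within
proof
  fix t assume t: "t \<in> T"
  show "continuous (at t within T) f"
  proof (cases "t \<in> ts_kappa T")
    case False
    \<comment> \<open>The only possible point outside \<open>ts_kappa\<close> is a left-scattered
      maximum. It is isolated, so continuity there is automatic.\<close>
    then have max: "\<forall>s\<in>T. s \<le> t" and "bwd_jump T t < t" using t by (auto simp: ts_kappa_def)
    moreover have "s \<le> bwd_jump T t" if "s \<in> T" "s < t" for s
      using that by (auto simp: bwd_jump_def intro!: cSup_upper bdd_aboveI[of _ t])
    ultimately have "t - s \<ge> t - bwd_jump T t" if "s \<in> T" "s \<noteq> t" for s
      using that by (simp add: order_less_le)
    then have "\<not> t islimpt T" using \<open>bwd_jump T t < t\<close>
      unfolding islimpt_approachable dist_real_def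
      by (smt (verit))
    then have "at t within T = bot" by (simp add: trivial_limit_within)
    then show ?thesis by (simp only: continuous_bot)
  qed (use assms in auto)
qed

lemma delta_differentiable_continuous_on:
  assumes "\<And>t. t \<in> ts_kappa T \<Longrightarrow> has_delta_derivative T f (f' t) t"
  shows "continuous_on T f"
  using assms continuous_within_kappa_imp delta_derivative_continuous kappa_in by metis

text \<open>Induction along \<open>T\<close> replaces the mean value theorem. The estimate survives
  at the supremum \<open>c\<close> of the points up to which it holds, by continuity. If
  \<open>c < b\<close> it extends further: across a gap because \<open>f\<close> does not change, at
  a right-dense point by the derivative with tolerance \<open>e\<close>.\<close>

lemma zero_delta_derivative_le:
  assumes f: "\<And>t. t \<in> ts_kappa T \<Longrightarrow> has_delta_derivative T f 0 t"
    and ab: "a \<in> T" "b \<in> T" "a \<le> b" and "e > 0"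
  shows "\<bar>f b - f a\<bar> \<le> e * (b - a)"
proof -
  define P where "P s \<longleftrightarrow> \<bar>f s - f a\<bar> \<le> e * (s - a)" for s
  define A where "A = {t\<in>T. a \<le> t \<and> t \<le> b \<and> (\<forall>s\<in>T. a \<le> s \<and> s \<le> t \<longrightarrow> P s)}"
  define c where "c = Sup A"
  have cont: "continuous_on T f" using f by (rule delta_differentiable_continuous_on)
  have "a \<in> A" using ab by (auto simp: A_def P_def)
  have bdd: "bdd_above A" by (auto simp: A_def intro: bdd_aboveI[of _ b])
  have "c \<in> T" unfolding c_def
    by (rule closed_subset_contains_Sup[OF closed_T]) (use \<open>a \<in> A\<close> bdd in \<open>auto simp: A_def\<close>)
  have "a \<le> c" unfolding c_def using \<open>a \<in> A\<close> bdd by (rule cSup_upper)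
  have "c \<le> b" unfolding c_def by (rule cSup_least) (use \<open>a \<in> A\<close> in \<open>auto simp: A_def\<close>)
  have below: "P s" if "s \<in> T" "a \<le> s" "s < c" for s
  proof -
    obtain t where "t \<in> A" "s < t" using \<open>s < c\<close> \<open>a \<in> A\<close> bdd unfolding c_def
      by (metis empty_iff less_cSup_iff)
    then show ?thesis using that by (auto simp: A_def)
  qed
  have "P c"
  proof -
    have "\<bar>f c - f a\<bar> \<le> e * (c - a) + \<eta>" if "\<eta> > 0" for \<eta>
    proof -
      obtain d where "d > 0" and d: "\<And>s. s \<in> T \<Longrightarrow> \<bar>s - c\<bar> < d \<Longrightarrow> \<bar>f s - f c\<bar> < \<eta>"
        using cont \<open>c \<in> T\<close> \<open>\<eta> > 0\<close> unfolding continuous_on_iff dist_real_def by meson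
      obtain t where t: "t \<in> A" "c - d < t"
        using less_cSup_iff[of A "c - d"] \<open>a \<in> A\<close> bdd \<open>d > 0\<close> by (auto simp: c_def)
      have "t \<le> c" unfolding c_def using t bdd by (intro cSup_upper)
      have "\<bar>f t - f c\<bar> < \<eta>" using d[of t] t \<open>t \<le> c\<close> by (auto simp: A_def)
      moreover have "\<bar>f t - f a\<bar> \<le> e * (t - a)" using t by (auto simp: A_def P_def)
      moreover have "e * (t - a) \<le> e * (c - a)" using \<open>t \<le> c\<close> \<open>e > 0\<close> by simp
      ultimately show ?thesis by linarith
    qed
    then show ?thesis unfolding P_def by (rule field_le_epsilon)
  qed
  have "c \<in> A" using below \<open>P c\<close> \<open>c \<in> T\<close> \<open>a \<le> c\<close> \<open>c \<le> b\<close> by (force simp: A_def)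
  have "c = b"
  proof (rule ccontr)
    assume "c \<noteq> b"
    then have "c < b" using \<open>c \<le> b\<close> by simp
    then have k: "c \<in> ts_kappa T" using kappa_not_max \<open>c \<in> T\<close> ab by blast
    have "\<exists>s\<in>A. s > c"
    proof (cases "\<sigma> c = c")
      case False
      then have "\<sigma> c > c" using fwd_jump_ge[of c] by simp
      have "f (\<sigma> c) = f c" using delta_derivative_jump[OF f[OF k] \<open>c \<in> T\<close>] by simp
      moreover have "e * (c - a) \<le> e * (\<sigma> c - a)" using \<open>\<sigma> c > c\<close> \<open>e > 0\<close> by simp
      ultimately have "P (\<sigma> c)" using \<open>P c\<close> by (simp add: P_def)
      have "\<sigma> c \<in> A" unfolding A_def
      proof (intro CollectI conjI ballI impI)
        fix s assume "s \<in> T" "a \<le> s \<and> s \<le> \<sigma> c"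
        then consider "s = \<sigma> c" | "s \<le> c" using fwd_jump_le[of s c] by force
        then show "P s" using \<open>P (\<sigma> c)\<close> below \<open>P c\<close> \<open>s \<in> T\<close> \<open>a \<le> s \<and> _\<close> by cases (auto simp: le_less)
      qed (use fwd_jump_in \<open>c \<in> T\<close> \<open>\<sigma> c > c\<close> \<open>a \<le> c\<close> fwd_jump_le[OF ab(2) \<open>c < b\<close>] in auto)
      then show ?thesis using \<open>\<sigma> c > c\<close> by auto
    next
      case True
      obtain d where "d > 0" and d: "\<And>s. s \<in> T \<Longrightarrow> \<bar>s - c\<bar> < d \<Longrightarrow> \<bar>f c - f s\<bar> \<le> e * \<bar>c - s\<bar>"
        using f[OF k] \<open>e > 0\<close> True unfolding has_delta_derivative_def by auto
      obtain s where s: "s \<in> T" "c < s" "s < c + min d (b - c)"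
        using right_dense_approx[OF \<open>c \<in> T\<close> True, of "min d (b - c)"] \<open>d > 0\<close> \<open>c < b\<close> ab(2)
        by auto
      have "s \<in> A" unfolding A_def
      proof (intro CollectI conjI ballI impI)
        fix r assume r: "r \<in> T" "a \<le> r \<and> r \<le> s"
        show "P r"
        proof (cases "r \<le> c")
          case False
          then have "\<bar>f c - f r\<bar> \<le> e * (r - c)" using d[of r] r s by auto
          moreover have "e * (r - c) + e * (c - a) = e * (r - a)" by (simp add: algebra_simps)
          ultimately show ?thesis using \<open>P c\<close> unfolding P_def by linarith
        qed (use below \<open>P c\<close> r in \<open>auto simp: le_less\<close>)
      qed (use s \<open>a \<le> c\<close> in auto)
      then show ?thesis using s by auto
    qed
    then show False using bdd cSup_upper[of _ A] by (force simp: c_def)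
  qed
  then show ?thesis using \<open>P c\<close> by (simp add: P_def)
qed

lemma zero_delta_derivative_const:
  assumes f: "\<And>t. t \<in> ts_kappa T \<Longrightarrow> has_delta_derivative T f 0 t"
    and "a \<in> T" "b \<in> T"
  shows "f a = f b"
proof -
  have *: "f a = f b" if "a \<in> T" "b \<in> T" "a \<le> b" for a b
  proof -
    have "\<bar>f b - f a\<bar> \<le> 0 + \<eta>" if "\<eta> > 0" for \<eta>
    proof -
      \<comment> \<open>The added 1 keeps the slope defined when \<open>a = b\<close>.\<close>
      have "\<bar>f b - f a\<bar> \<le> \<eta> / (b - a + 1) * (b - a)"
        by (rule zero_delta_derivative_le[OF f \<open>a \<in> T\<close> \<open>b \<in> T\<close> \<open>a \<le> b\<close>])
           (use \<open>a \<le> b\<close> that in auto)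
      also have "\<dots> \<le> \<eta>"
      proof -
        have "\<eta> / (b - a + 1) * (b - a) \<le> \<eta> / (b - a + 1) * (b - a + 1)"
          using \<open>a \<le> b\<close> that by (intro mult_left_mono) auto
        then show ?thesis using \<open>a \<le> b\<close> by simp
      qed
      finally show ?thesis by simp
    qed
    then have "\<bar>f b - f a\<bar> \<le> 0" by (rule field_le_epsilon)
    then show ?thesis by simp
  qed
  show ?thesis
  proof (cases "a \<le> b")
    case True
    then show ?thesis using *[of a b] assms(2,3) by blast
  next
    case False
    then show ?thesis using *[of b a] assms(2,3) by simp
  qed
qed

lemma delta_integral_eq:
  assumes "delta_antiderivative T F f" "a \<in> T" "b \<in> T"
  shows "delta_integral T a b f = F b - F a"
  unfolding delta_integral_def
proof (rule the_equality)
  fix I assume "\<exists>F. delta_antiderivative T F f \<and> I = F b - F a"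
  then obtain G where G: "delta_antiderivative T G f" "I = G b - G a" by auto
  have "has_delta_derivative T (\<lambda>s. F s - G s) 0 t" if "t \<in> ts_kappa T" for t
    using has_delta_derivative_diff[of F "f t" t G "f t"] assms G that kappa_in
    by (simp add: delta_antiderivative_def)
  from zero_delta_derivative_const[OF this, of a b] assms G show "I = F b - F a" by simp
qed (use assms in auto)

subsection \<open>Existence of antiderivatives\<close>

text \<open>Below the minimum of \<open>T\<close>, if there is one, the value is that minimum, so that \<open>ts_floor\<close>
  is a monotone retraction of the line onto \<open>T\<close>.\<close>

definition ts_floor :: "real \<Rightarrow> real" where
  "ts_floor r = (if {s \<in> T. s \<le> r} = {} then Inf T else Sup {s \<in> T. s \<le> r})"

lemma ts_floor_in: "ts_floor r \<in> T"
proof (cases "{s \<in> T. s \<le> r} = {}")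
  case True
  then have "bdd_below T" by (intro bdd_belowI[of _ r]) force
  then have "Inf T \<in> T" using closed_contains_Inf closed_T T_nonempty by blast
  with True show ?thesis by (simp add: ts_floor_def)
next
  case False
  have "Sup {s \<in> T. s \<le> r} \<in> T"
    by (rule closed_subset_contains_Sup[OF closed_T])
       (use False in \<open>auto intro!: bdd_aboveI[of _ r]\<close>)
  with False show ?thesis by (simp only: ts_floor_def if_False)
qed

lemma ts_floor_ge: "s \<in> T \<Longrightarrow> s \<le> r \<Longrightarrow> s \<le> ts_floor r"
  by (auto simp: ts_floor_def intro!: cSup_upper bdd_aboveI[of _ r])

lemma ts_floor_le: 
  assumes "s \<in> T" "s \<le> r" shows "ts_floor r \<le> r"
proof -
  have "{s \<in> T. s \<le> r} \<noteq> {}" using assms by auto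
  then show ?thesis unfolding ts_floor_def by (simp only: if_False) (rule cSup_least, auto)
qed

lemma ts_floor_eq: "r \<in> T \<Longrightarrow> ts_floor r = r"
  using ts_floor_ge ts_floor_le by (intro antisym) auto

lemma mono_ts_floor: "mono ts_floor"
proof (rule monoI)
  fix r s :: real assume "r \<le> s"
  show "ts_floor r \<le> ts_floor s"
  proof (cases "{q \<in> T. q \<le> r} = {}")
    case True
    then have "bdd_below T" by (intro bdd_belowI[of _ r]) force
    then have "Inf T \<le> ts_floor s" using ts_floor_in by (intro cInf_lower)
    with True show ?thesis by (simp add: ts_floor_def[of r])
  next
    case False
    then have "ts_floor r \<le> r" using ts_floor_le by auto
    then show ?thesis using ts_floor_ge ts_floor_in \<open>r \<le> s\<close> by simp
  qed
qed

text \<open>Points just left of \<open>r\<close> have jump at most \<open>r\<close>, so a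
  right-scattered \<open>r\<close> is a discontinuity of the monotone \<open>\<sigma>\<close>.
  Consequently there are only countably many such points.\<close>

lemma isCont_fwd_jump_imp_right_dense:
  assumes "isCont \<sigma> r" "r \<in> T" shows "\<sigma> r = r"
proof (rule ccontr)
  assume "\<sigma> r \<noteq> r"
  then have "\<sigma> r - r > 0" using fwd_jump_ge[of r] by simp
  then obtain d where "d > 0" and d: "\<And>s. \<bar>s - r\<bar> < d \<Longrightarrow> \<bar>\<sigma> s - \<sigma> r\<bar> < \<sigma> r - r"
    using assms unfolding continuous_at_eps_delta dist_real_def by meson
  from d[of "r - d / 2"] \<open>d > 0\<close> fwd_jump_le[of r "r - d / 2"] assms(2) show False
    by auto
qed

text \<open>The composite can fail to be continuous only where one of the monotone functions
  \<open>ts_floor\<close> and \<open>\<sigma>\<close> does, which is a countable set. Elsewhere a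
  point of \<open>T\<close> is right-dense, so \<open>f\<close> is continuous there, and off
  \<open>T\<close> the floor is locally constant.\<close>

lemma measurable_floor_comp:
  assumes "\<And>t. t \<in> T \<Longrightarrow> \<sigma> t = t \<Longrightarrow> continuous (at t within T) f"
  shows "(\<lambda>r. f (ts_floor r) :: real) \<in> borel_measurable borel"
proof (rule borel_measurable_continuous_countable_exceptions)
  define X where "X = {r. \<not> isCont ts_floor r} \<union> {r. \<not> isCont \<sigma> r}"
  show "countable X" unfolding X_def
    using mono_ctble_discont[OF mono_ts_floor] mono_ctble_discont[OF mono_fwd_jump] by simp
  have "isCont (\<lambda>r. f (ts_floor r)) r" if "r \<notin> X" for r
  proof (cases "r \<in> T")
    case True
    have "\<sigma> r = r" using isCont_fwd_jump_imp_right_dense True that by (auto simp: X_def)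
    then have f: "continuous (at r within T) f" using assms True by simp
    have fl: "isCont ts_floor r" using that by (simp add: X_def)
    show ?thesis unfolding continuous_at_eps_delta
    proof (intro allI impI)
      fix e :: real assume "e > 0"
      obtain d where "d > 0" and d: "\<And>s. s \<in> T \<Longrightarrow> dist s r < d \<Longrightarrow> dist (f s) (f r) < e"
        using f \<open>e > 0\<close> unfolding continuous_within_eps_delta by meson
      obtain d' where "d' > 0" and d': "\<And>s. dist s r < d' \<Longrightarrow> dist (ts_floor s) (ts_floor r) < d"
        using fl \<open>d > 0\<close> unfolding continuous_at_eps_delta by meson
      show "\<exists>d>0. \<forall>x'. dist x' r < d \<longrightarrow> dist (f (ts_floor x')) (f (ts_floor r)) < e"
      proof (intro exI[of _ d'] conjI allI impI)
        fix x assume "dist x r < d'"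
        then show "dist (f (ts_floor x)) (f (ts_floor r)) < e"
          using d[OF ts_floor_in, of x] d'[of x] ts_floor_eq[OF True] by simp
      qed fact
    qed
  next
    case False
    then obtain d where "d > 0" and d: "ball r d \<subseteq> - T"
      using closed_T open_contains_ball[of "- T"] by auto
    have *: "ts_floor x = ts_floor r" if "dist x r < d" for x
    proof -
      have "s \<le> x \<longleftrightarrow> s \<le> r" if "s \<in> T" for s
      proof -
        have "dist r s \<ge> d" using d that by force
        then show ?thesis using \<open>dist x r < d\<close> by (auto simp: dist_real_def)
      qed
      then have "{s \<in> T. s \<le> x} = {s \<in> T. s \<le> r}" by auto
      then show ?thesis by (simp only: ts_floor_def)
    qed
    show ?thesis unfolding continuous_at_eps_delta
    proof (intro allI impI exI[of _ d] conjI)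
      fix e :: real and x assume "e > 0" "dist x r < d"
      then show "dist (f (ts_floor x)) (f (ts_floor r)) < e" using *[of x] by simp
    qed (rule \<open>d > 0\<close>)
  qed
  then show "continuous_on (- X) (\<lambda>r. f (ts_floor r))"
    by (auto intro: continuous_at_imp_continuous_on)
qed

text \<open>The function \<open>f \<circ> ts_floor\<close> is constant on the gaps of \<open>T\<close>, so its indefinite integral over
  the line has the increment \<open>f t * \<mu> t\<close> across the gap starting at \<open>t\<close>.\<close>

lemma delta_integrableI:
  assumes cont: "\<And>t. t \<in> T \<Longrightarrow> \<sigma> t = t \<Longrightarrow> continuous (at t within T) f"
    and bnd: "\<And>a b. a \<in> T \<Longrightarrow> b \<in> T \<Longrightarrow> bounded (f ` (T \<inter> {a..b}))"
  shows "delta_integrable T f"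
proof -
  define g where "g r = f (ts_floor r)" for r
  have fl: "ts_floor r \<in> T \<inter> {a..b}" if "a \<in> T" "b \<in> T" "r \<in> {a..b}" for a b r
    using that ts_floor_in ts_floor_ge[of a r] ts_floor_le[of a r] by auto
  have int: "g integrable_on {a..b}" if ab: "a \<in> T" "b \<in> T" for a b
  proof -
    obtain B where B: "\<And>s. s \<in> T \<inter> {a..b} \<Longrightarrow> \<bar>f s\<bar> \<le> B"
      using bnd[OF ab] unfolding bounded_iff by (metis image_eqI real_norm_def)
    show ?thesis
    proof (rule measurable_bounded_by_integrable_imp_integrable_real)
      have "g \<in> borel_measurable borel" unfolding g_def using cont by (rule measurable_floor_comp)
      then show "g \<in> borel_measurable (lebesgue_on {a..b})"
        by (simp add: measurable_completion measurable_restrict_space1)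
      show "(\<lambda>_. B) integrable_on {a..b}" by (rule integrable_const_ivl)
      show "\<bar>g x\<bar> \<le> B" if "x \<in> {a..b}" for x
        using B[OF fl[OF ab that]] by (simp add: g_def)
    qed simp
  qed
  obtain t0 where t0: "t0 \<in> T" using T_nonempty by auto
  define F where "F t = (if t0 \<le> t then integral {t0..t} g else - integral {t..t0} g)" for t
  have F: "(g has_integral (F b - F a)) {a..b}" if ab: "a \<in> T" "b \<in> T" "a \<le> b" for a b
  proof -
    have c: "integral {x..y} g + integral {y..z} g = integral {x..z} g"
      if "x \<in> T" "z \<in> T" "x \<le> y" "y \<le> z" for x y z
      using Henstock_Kurzweil_Integration.integral_combine[OF that(3,4) int[OF that(1,2)]] .
    have "F b - F a = integral {a..b} g"
      using c[of t0 b a] c[of a t0 b] c[of a b t0] ab t0 by (auto simp: F_def)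
    then show ?thesis using int[OF ab(1,2)] by (simp add: has_integral_iff)
  qed
  \<comment> \<open>The endpoint \<open>b\<close> is exempted as a null set: when
    \<open>b = \<sigma> t\<close>, the integrand equals \<open>f t\<close> on the whole gap except
    at \<open>b\<close>. Tolerance 0 then yields the exact increment, and \<open>c = 0\<close>
    yields continuity.\<close>
  have est: "\<bar>F b - F a - c * (b - a)\<bar> \<le> e * (b - a)"
    if ab: "a \<in> T" "b \<in> T" "a \<le> b" and "e \<ge> 0"
      and near: "\<And>q. q \<in> T \<Longrightarrow> a \<le> q \<Longrightarrow> q < b \<Longrightarrow> \<bar>f q - c\<bar> \<le> e" for a b c e
  proof -
    have "((\<lambda>r. g r - c) has_integral (F b - F a - c * (b - a))) {a..b}"
      using has_integral_diff[OF F[OF ab] has_integral_const_real[of c a b]] \<open>a \<le> b\<close>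
      by (simp add: mult.commute)
    then have "norm (F b - F a - c * (b - a)) \<le> e * measure lborel {a..b}"
    proof (rule has_integral_bound_real[OF \<open>e \<ge> 0\<close>, of "{b}", rotated])
      fix r assume r: "r \<in> {a..b} - {b}"
      then have "ts_floor r \<le> r" using ts_floor_le ab by auto
      then show "norm (g r - c) \<le> e" using near[of "ts_floor r"] fl[OF ab(1,2), of r] r
        by (auto simp: g_def)
    qed simp
    then show ?thesis using \<open>a \<le> b\<close> by simp
  qed
  have "has_delta_derivative T F (f t) t" if t: "t \<in> T" for t
  proof (cases "\<sigma> t = t")
    case True
    show ?thesis unfolding has_delta_derivative_def
    proof (intro allI impI)
      fix e :: real assume "e > 0"
      obtain d where "d > 0" and d: "\<And>s. s \<in> T \<Longrightarrow> \<bar>s - t\<bar> < d \<Longrightarrow> \<bar>f s - f t\<bar> < e"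
        using cont[OF t True] \<open>e > 0\<close> unfolding continuous_within_eps_delta dist_real_def by meson
      show "\<exists>\<delta>>0. \<forall>s\<in>T. \<bar>s - t\<bar> < \<delta> \<longrightarrow>
          \<bar>F (\<sigma> t) - F s - f t * (\<sigma> t - s)\<bar> \<le> e * \<bar>\<sigma> t - s\<bar>"
      proof (intro exI[of _ d] conjI ballI impI)
        fix s assume s: "s \<in> T" "\<bar>s - t\<bar> < d"
        show "\<bar>F (\<sigma> t) - F s - f t * (\<sigma> t - s)\<bar> \<le> e * \<bar>\<sigma> t - s\<bar>"
        proof (cases "s \<le> t")
          case True
          have "\<bar>F t - F s - f t * (t - s)\<bar> \<le> e * (t - s)"
          proof (rule est[OF s(1) t True])
            fix q assume "q \<in> T" "s \<le> q" "q < t"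
            then show "\<bar>f q - f t\<bar> \<le> e" using d[of q] s by auto
          qed (use \<open>e > 0\<close> in simp)
          then show ?thesis using True \<open>\<sigma> t = t\<close> by simp
        next
          case False
          have "\<bar>F s - F t - f t * (s - t)\<bar> \<le> e * (s - t)"
          proof (rule est[OF t s(1)])
            fix q assume "q \<in> T" "t \<le> q" "q < s"
            then show "\<bar>f q - f t\<bar> \<le> e" using d[of q] s by auto
          qed (use \<open>e > 0\<close> False in auto)
          moreover have "F t - F s - f t * (t - s) = - (F s - F t - f t * (s - t))"
            by (simp add: algebra_simps)
          ultimately show ?thesis using False \<open>\<sigma> t = t\<close> by (simp only: abs_minus_cancel) simp
        qed
      qed fact
    qed
  next
    case False
    then have gt: "\<sigma> t > t" using fwd_jump_ge[of t] by simp
    have "\<bar>F (\<sigma> t) - F t - f t * (\<sigma> t - t)\<bar> \<le> 0 * (\<sigma> t - t)"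
    proof (rule est[OF t fwd_jump_in[OF t] fwd_jump_ge])
      fix q assume "q \<in> T" "t \<le> q" "q < \<sigma> t"
      then have "q = t" using fwd_jump_le[of q t] by force
      then show "\<bar>f q - f t\<bar> \<le> 0" by simp
    qed simp
    then have jump: "F (\<sigma> t) = F t + f t * graininess T t" by (simp add: graininess_def)
    \<comment> \<open>This is a point of \<open>T\<close> below every point of \<open>T\<close>
      within distance 1 of \<open>t\<close>; if \<open>T\<close> has no point up to
      \<open>t - 1\<close>, it is the minimum. A bound for \<open>f\<close> on
      \<open>T \<inter> {a..t}\<close> therefore serves all nearby \<open>s\<close>.\<close>
    define a where "a = ts_floor (t - 1)"
    have a: "a \<in> T" by (simp add: a_def ts_floor_in)
    obtain B where B: "\<And>s. s \<in> T \<inter> {a..t} \<Longrightarrow> \<bar>f s\<bar> \<le> B"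
      using bnd[OF a t] unfolding bounded_iff by (metis image_eqI real_norm_def)
    have "continuous (at t within T) F"
      unfolding continuous_within_eps_delta
    proof (intro allI impI)
      fix e :: real assume "e > 0"
      define d where "d = min (min 1 (\<sigma> t - t)) (e / (\<bar>B\<bar> + 1))"
      have "d > 0" using \<open>e > 0\<close> gt by (simp add: d_def add_nonneg_pos)
      have "dist (F s) (F t) < e" if s: "s \<in> T" "dist s t < d" for s
      proof -
        have "s \<le> t" using fwd_jump_le[of s t] s by (force simp: d_def dist_real_def)
        have "t - 1 \<le> s" using s by (auto simp: d_def dist_real_def)
        then have "a \<le> s" using monoD[OF mono_ts_floor \<open>t - 1 \<le> s\<close>] ts_floor_eq[OF s(1)]
          by (simp add: a_def)
        have "\<bar>F t - F s - 0 * (t - s)\<bar> \<le> \<bar>B\<bar> * (t - s)"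
        proof (rule est[OF s(1) t \<open>s \<le> t\<close>])
          fix q assume "q \<in> T" "s \<le> q" "q < t"
          then show "\<bar>f q - 0\<bar> \<le> \<bar>B\<bar>" using B[of q] \<open>a \<le> s\<close> by auto
        qed simp
        also have "\<dots> \<le> (\<bar>B\<bar> + 1) * (t - s)" using \<open>s \<le> t\<close> by (intro mult_right_mono) auto
        also have "\<dots> < (\<bar>B\<bar> + 1) * (e / (\<bar>B\<bar> + 1))"
          using s by (intro mult_strict_left_mono) (auto simp: d_def dist_real_def)
        also have "\<dots> = e" by simp
        finally show ?thesis by (simp add: dist_real_def abs_minus_commute)
      qed
      then show "\<exists>d>0. \<forall>x'\<in>T. dist x' t < d \<longrightarrow> dist (F x') (F t) < e" using \<open>d > 0\<close> by auto
    qed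
    then show ?thesis using jump False t by (simp add: has_delta_derivative_iff)
  qed
  then show ?thesis
    unfolding delta_integrable_def delta_antiderivative_def using kappa_in by blast
qed

section \<open>Integrability of products with a jump and of functions of the graininess\<close>

lemma continuous_graininess:
  "t \<in> T \<Longrightarrow> \<sigma> t = t \<Longrightarrow> continuous (at t within T) (graininess T)"
  using continuous_fwd_jump[of t] unfolding graininess_def by (intro continuous_intros) auto

lemma graininess_nonneg: "graininess T t \<ge> 0"
  using fwd_jump_ge[of t] by (simp add: graininess_def)

text \<open>With \<open>k = 1 / e\<close> this covers the variation of constants integrand.
  Continuity of \<open>\<sigma>\<close> at right-dense points gives the first requirement. For the
  second, \<open>\<sigma>\<close> may leave \<open>{a..b}\<close>, but only up to
  \<open>\<sigma> b\<close>, so compactness of \<open>T \<inter> {a..\<sigma> b}\<close> bounds the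
  second factor.\<close>

lemma delta_integrable_mult_jump:
  assumes h: "continuous_on T h" and k: "continuous_on T k"
  shows "delta_integrable T (\<lambda>t. h t * k (\<sigma> t))"
proof (rule delta_integrableI)
  fix t assume t: "t \<in> T" "\<sigma> t = t"
  have "continuous (at t within T) (\<lambda>s. k (\<sigma> s))"
  proof -
    have "continuous (at (\<sigma> t) within T) k" using k t by (simp add: continuous_on_eq_continuous_within)
    then have "continuous (at (\<sigma> t) within \<sigma> ` T) k"
      by (rule continuous_within_subset) (use fwd_jump_in in auto)
    with continuous_fwd_jump[OF t] show ?thesis by (rule continuous_within_compose2)
  qed
  then show "continuous (at t within T) (\<lambda>t. h t * k (\<sigma> t))"
    using h t by (auto simp: continuous_on_eq_continuous_within intro!: continuous_intros)
next
  fix a b assume ab: "a \<in> T" "b \<in> T"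
  have c: "compact (T \<inter> {x..y})" for x y using closed_T by (simp add: closed_Int_compact)
  have "bounded (h ` (T \<inter> {a..b}))"
    by (intro compact_imp_bounded compact_continuous_image c continuous_on_subset[OF h]) auto
  then obtain H where H: "\<And>s. s \<in> T \<inter> {a..b} \<Longrightarrow> \<bar>h s\<bar> \<le> H"
    unfolding bounded_iff by (metis image_eqI real_norm_def)
  have "bounded (k ` (T \<inter> {a..\<sigma> b}))"
    by (intro compact_imp_bounded compact_continuous_image c continuous_on_subset[OF k]) auto
  then obtain K where K: "\<And>s. s \<in> T \<inter> {a..\<sigma> b} \<Longrightarrow> \<bar>k s\<bar> \<le> K"
    unfolding bounded_iff by (metis image_eqI real_norm_def)
  have "\<bar>h s * k (\<sigma> s)\<bar> \<le> H * K" if s: "s \<in> T \<inter> {a..b}" for s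
  proof -
    have "\<sigma> s \<in> T \<inter> {a..\<sigma> b}"
      using s fwd_jump_in fwd_jump_ge[of s] monoD[OF mono_fwd_jump, of s b] by auto
    from K[OF this] H[OF s] show ?thesis by (simp add: abs_mult mult_mono')
  qed
  then show "bounded ((\<lambda>t. h t * k (\<sigma> t)) ` (T \<inter> {a..b}))"
    by (intro boundedI[of _ "H * K"]) auto
qed

text \<open>Such points are at least \<open>d\<close> apart, so dividing by \<open>d\<close> and
  rounding down separates them.\<close>

lemma finite_large_graininess:
  assumes "d > 0"
  shows "finite {t \<in> T \<inter> {a..b}. graininess T t \<ge> d}" (is "finite ?S")
proof (rule inj_on_finite)
  have "\<lfloor>s / d\<rfloor> < \<lfloor>t / d\<rfloor>" if "s \<in> ?S" "t \<in> ?S" "s < t" for s t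
  proof -
    have "s + d \<le> t" using that fwd_jump_le[of t s] by (auto simp: graininess_def)
    then have "(s + d) / d \<le> t / d" using assms by (intro divide_right_mono) auto
    then have "s / d + 1 \<le> t / d" using assms by (simp add: add_divide_distrib)
    then show ?thesis by linarith
  qed
  then show "inj_on (\<lambda>t. \<lfloor>t / d\<rfloor>) ?S" by (intro linorder_inj_onI') (auto simp: less_le)
  show "(\<lambda>t. \<lfloor>t / d\<rfloor>) ` ?S \<subseteq> {\<lfloor>a / d\<rfloor>..\<lfloor>b / d\<rfloor>}"
    using assms by (auto intro!: floor_mono divide_right_mono)
qed simp

text \<open>Right-dense points have graininess 0, so continuity of \<open>\<psi>\<close> at 0 alone
  gives continuity there. Boundedness holds because all but finitely many points of a bounded piece
  have graininess close to 0.\<close>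

lemma delta_integrable_graininess:
  assumes "isCont \<psi> 0"
  shows "delta_integrable T (\<lambda>t. \<psi> (graininess T t))"
proof (rule delta_integrableI)
  fix t assume t: "t \<in> T" "\<sigma> t = t"
  have "graininess T t = 0" using t by (simp add: graininess_def)
  then have "(graininess T \<longlongrightarrow> 0) (at t within T)"
    using continuous_graininess[OF t] by (simp add: continuous_within)
  from isCont_tendsto_compose[OF assms this]
  show "continuous (at t within T) (\<lambda>t. \<psi> (graininess T t))"
    by (simp only: continuous_within \<open>graininess T t = 0\<close>)
next
  fix a b assume "a \<in> T" "b \<in> T"
  obtain d where "d > 0" and d: "\<And>m. \<bar>m\<bar> < d \<Longrightarrow> \<bar>\<psi> m - \<psi> 0\<bar> < 1"
    using assms unfolding continuous_at_eps_delta dist_real_def by (metis diff_zero zero_less_one)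
  let ?S = "{t \<in> T \<inter> {a..b}. graininess T t \<ge> d}"
  have "(\<lambda>t. \<psi> (graininess T t)) ` (T \<inter> {a..b}) \<subseteq> cball (\<psi> 0) 1 \<union> (\<lambda>t. \<psi> (graininess T t)) ` ?S"
  proof
    fix y assume "y \<in> (\<lambda>t. \<psi> (graininess T t)) ` (T \<inter> {a..b})"
    then obtain t where t: "t \<in> T \<inter> {a..b}" "y = \<psi> (graininess T t)" by auto
    show "y \<in> cball (\<psi> 0) 1 \<union> (\<lambda>t. \<psi> (graininess T t)) ` ?S"
    proof (cases "graininess T t \<ge> d")
      case False
      then show ?thesis using d[of "graininess T t"] graininess_nonneg[of t] t
        by (auto simp: dist_real_def)
    qed (use t in auto)
  qed
  moreover have "bounded (cball (\<psi> 0) 1 \<union> (\<lambda>t. \<psi> (graininess T t)) ` ?S)"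
    using finite_large_graininess[OF \<open>d > 0\<close>] by (intro bounded_Un[THEN iffD2]) (auto intro: finite_imp_bounded)
  ultimately show "bounded ((\<lambda>t. \<psi> (graininess T t)) ` (T \<inter> {a..b}))"
    using bounded_subset by blast
qed

subsection \<open>The exponential function\<close>

text \<open>The solution is \<open>exp F * cos G\<close>. The modulus comes from integrating \<open>ln \<bar>1 + \<mu> p\<bar> / \<mu>\<close>
  (\<open>ln\<close> of a negative real is \<open>ln\<close> of its absolute value); the sign is carried by \<open>cos G\<close>, where
  \<open>G\<close> grows by \<open>pi\<close> across each gap with \<open>1 + \<mu> p < 0\<close>. Since \<open>sin\<^sup>2 G\<close> has zero derivative, it
  vanishes identically, so \<open>cos G\<close> has no zeros.\<close>

lemma nonvanishing_exponential_exists: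
  assumes reg: "regressive T (\<lambda>_. p)" and t0: "t0 \<in> T"
  shows "\<exists>e. (\<forall>t\<in>ts_kappa T. has_delta_derivative T e (p * e t) t) \<and> (\<forall>t\<in>T. e t \<noteq> 0) \<and> e t0 = 1"
proof -
  define L where "L m = (if m = 0 then p else ln (1 + m * p) / m)" for m :: real
  define N where "N m = (if 1 + m * p < 0 then pi / m else 0)" for m :: real
  obtain F where F: "\<And>t. t \<in> ts_kappa T \<Longrightarrow> has_delta_derivative T F (L (graininess T t)) t"
    using delta_integrable_graininess[OF isCont_ln_div[of p]]
    by (auto simp: delta_integrable_def delta_antiderivative_def L_def)
  obtain G0 where G0: "\<And>t. t \<in> ts_kappa T \<Longrightarrow> has_delta_derivative T G0 (N (graininess T t)) t"
    using delta_integrable_graininess[OF isCont_neg_jump[of p]]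
    by (auto simp: delta_integrable_def delta_antiderivative_def N_def)
  define G where "G t = G0 t - G0 t0" for t
  have G: "has_delta_derivative T G (N (graininess T t)) t" if "t \<in> ts_kappa T" for t
    using has_delta_derivative_diff[OF G0[OF that] has_delta_derivative_const[of t "G0 t0"]] that kappa_in
    by (simp add: G_def[abs_def])
  have r: "1 + graininess T t * p \<noteq> 0" if "t \<in> T" for t
    using reg that by (simp add: regressive_def)
  have trig: "cos (G (\<sigma> t)) = (if 1 + graininess T t * p < 0 then - cos (G t) else cos (G t))"
    "sin (G (\<sigma> t)) = (if 1 + graininess T t * p < 0 then - sin (G t) else sin (G t))"
    if t: "t \<in> ts_kappa T" for t
  proof -
    have "G (\<sigma> t) = G t + N (graininess T t) * graininess T t"
      using delta_derivative_jump[OF G[OF t]] kappa_in[OF t] .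
    also have "\<dots> = G t + (if 1 + graininess T t * p < 0 then pi else 0)"
      by (auto simp: N_def)
    finally show "cos (G (\<sigma> t)) = (if 1 + graininess T t * p < 0 then - cos (G t) else cos (G t))"
      "sin (G (\<sigma> t)) = (if 1 + graininess T t * p < 0 then - sin (G t) else sin (G t))"
      by simp_all
  qed
  have dense: "(F has_real_derivative p) (at t within T)" "(G has_real_derivative 0) (at t within T)"
    if "t \<in> ts_kappa T" "\<sigma> t = t" for t
    using F[OF that(1)] G[OF that(1)] that kappa_in[OF that(1)]
    by (simp_all add: has_delta_derivative_iff graininess_def L_def N_def)
  have contFG: "continuous (at t within T) F" "continuous (at t within T) G" if "t \<in> ts_kappa T" for t
    using delta_derivative_continuous F G kappa_in that by blast+
  \<comment> \<open>The square is taken because \<open>sin G\<close> itself changes sign across the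
    gaps with a negative factor; its value at \<open>t0\<close> is 0 by the normalisation of
    \<open>G\<close>.\<close>
  have "has_delta_derivative T (\<lambda>s. sin (G s) * sin (G s)) 0 t" if t: "t \<in> ts_kappa T" for t
  proof (cases "\<sigma> t = t")
    case True
    have "((\<lambda>s. sin (G s) * sin (G s)) has_real_derivative 0) (at t within T)"
      by (rule derivative_eq_intros dense(2)[OF t True] refl)+ simp
    then show ?thesis using True t kappa_in by (simp add: has_delta_derivative_iff)
  next
    case False
    then show ?thesis using t kappa_in[OF t] contFG[OF t] trig[OF t]
      by (auto simp: has_delta_derivative_iff intro!: continuous_intros continuous_within_sin)
  qed
  from zero_delta_derivative_const[OF this] have "sin (G t) * sin (G t) = 0" if "t \<in> T" for t
    using that t0 by (metis (no_types) G_def diff_self mult_zero_left sin_zero)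
  then have cos: "cos (G t) \<noteq> 0" if "t \<in> T" for t
    using that sin_zero_abs_cos_one[of "G t"] by fastforce
  define e where "e t = exp (F t - F t0) * cos (G t)" for t
  have "has_delta_derivative T e (p * e t) t" if t: "t \<in> ts_kappa T" for t
  proof (cases "\<sigma> t = t")
    case True
    have "((\<lambda>s. exp (F s - F t0) * cos (G s)) has_real_derivative p * e t) (at t within T)"
      by (rule derivative_eq_intros dense[OF t True] refl)+ (simp add: e_def)
    then show ?thesis using True t kappa_in by (simp add: has_delta_derivative_iff e_def[abs_def])
  next
    case False
    then have m: "graininess T t \<noteq> 0" by (simp add: graininess_def)
    have "F (\<sigma> t) = F t + ln (1 + graininess T t * p)"
      using delta_derivative_jump[OF F[OF t]] kappa_in[OF t] m by (simp add: L_def)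
    then have "exp (F (\<sigma> t) - F t0) = exp (F t - F t0) * exp (ln (1 + graininess T t * p))"
      by (simp add: exp_add[symmetric])
    also have "exp (ln (1 + graininess T t * p)) = \<bar>1 + graininess T t * p\<bar>"
      using r[OF kappa_in[OF t]] by (rule exp_ln_abs)
    \<comment> \<open>The modulus from \<open>exp F\<close> and the sign from \<open>cos G\<close>
      recombine to the factor \<open>1 + graininess T t * p\<close>.\<close>
    finally have "e (\<sigma> t) = e t + p * e t * graininess T t"
      using trig(1)[OF t] by (auto simp: e_def algebra_simps abs_if)
    moreover have "continuous (at t within T) e" unfolding e_def[abs_def]
      using contFG[OF t] by (intro continuous_intros continuous_within_cos) auto
    ultimately show ?thesis using False t kappa_in by (simp add: has_delta_derivative_iff)
  qed
  moreover have "e t \<noteq> 0" if "t \<in> T" for t using cos[OF that] by (simp add: e_def)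
  moreover have "e t0 = 1" by (simp add: e_def G_def)
  ultimately show ?thesis by blast
qed

end

section \<open>Exponential kernels and variation of constants\<close>

locale timescale_exp = timescale +
  fixes p :: real and e :: "real \<Rightarrow> real"
  assumes exp_deriv: "t \<in> ts_kappa T \<Longrightarrow> has_delta_derivative T e (p * e t) t"
    and exp_nonzero: "t \<in> T \<Longrightarrow> e t \<noteq> 0"
begin

lemma exp_continuous: "continuous_on T e"
  using exp_deriv by (rule delta_differentiable_continuous_on)

text \<open>The integrating factor: division by \<open>e\<close> removes the homogeneous term
  \<open>p * z t\<close>.\<close>

lemma has_delta_derivative_div_exp:
  assumes "has_delta_derivative T z D t" "t \<in> ts_kappa T"
  shows "has_delta_derivative T (\<lambda>s. z s / e s) ((D - p * z t) / e (\<sigma> t)) t"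
proof -
  have t: "t \<in> T" using assms kappa_in by simp
  have "has_delta_derivative T (\<lambda>s. 1 / e s * z s)
      (- (p * e t) / (e t * e (\<sigma> t)) * z t + 1 / e (\<sigma> t) * D) t"
    using has_delta_derivative_mult has_delta_derivative_inverse exp_deriv exp_nonzero
      fwd_jump_in t assms by meson
  moreover have "- (p * e t) / (e t * e (\<sigma> t)) * z t + 1 / e (\<sigma> t) * D = (D - p * z t) / e (\<sigma> t)"
    using exp_nonzero[OF t] exp_nonzero[OF fwd_jump_in[OF t]] by (simp add: field_simps)
  ultimately show ?thesis by simp
qed

lemma has_delta_derivative_exp_mult:
  assumes "has_delta_derivative T V (D / e (\<sigma> t)) t" "t \<in> ts_kappa T"
  shows "has_delta_derivative T (\<lambda>s. e s * V s) (p * (e t * V t) + D) t"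
  using has_delta_derivative_mult[OF exp_deriv[OF assms(2)] assms(1)] assms(2) kappa_in
    exp_nonzero[OF fwd_jump_in] by (simp add: mult.assoc)

text \<open>The quotient of any competing solution by \<open>e\<close> has zero derivative, so the
  value is determined. Being a quotient, it does not depend on the normalisation of
  \<open>e\<close>, and it separates the two arguments.\<close>

lemma ts_exp_eq:
  assumes "t \<in> T" "s \<in> T"
  shows "ts_exp T (\<lambda>_. p) t s = e t / e s"
  unfolding ts_exp_def
proof (rule the_equality)
  have "has_delta_derivative T (\<lambda>r. 1 / e s * e r) (p * (1 / e s * e r)) r" if "r \<in> ts_kappa T" for r
    using has_delta_derivative_cmult[OF exp_deriv[OF that], of "1 / e s"] that kappa_in
    by (simp add: mult.left_commute)
  then show "\<exists>y. (\<forall>\<tau>\<in>ts_kappa T. has_delta_derivative T y (p * y \<tau>) \<tau>) \<and> y s = 1 \<and> e t / e s = y t"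
    using exp_nonzero[OF assms(2)] by (intro exI[of _ "\<lambda>r. 1 / e s * e r"]) auto
next
  fix v assume "\<exists>y. (\<forall>\<tau>\<in>ts_kappa T. has_delta_derivative T y (p * y \<tau>) \<tau>) \<and> y s = 1 \<and> v = y t"
  then obtain y where y: "\<And>r. r \<in> ts_kappa T \<Longrightarrow> has_delta_derivative T y (p * y r) r" "y s = 1" "v = y t"
    by blast
  have "has_delta_derivative T (\<lambda>r. y r / e r) 0 r" if "r \<in> ts_kappa T" for r
    using has_delta_derivative_div_exp[OF y(1)[OF that] that] by simp
  from zero_delta_derivative_const[OF this assms] have "y t / e t = y s / e s" .
  then show "v = e t / e s" using y exp_nonzero[OF assms(1)] by (simp add: field_simps)
qed

text \<open>The outer argument \<open>t\<close> enters the kernel only through the constant factor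
  \<open>e t\<close>, so a single \<open>V\<close> serves for every \<open>t\<close>.\<close>

lemma convolution_antiderivative:
  assumes V: "delta_antiderivative T V (\<lambda>\<tau>. v \<tau> / e (\<sigma> \<tau>))" and t: "t \<in> T"
  shows "delta_antiderivative T (\<lambda>s. e t * V s) (\<lambda>\<tau>. ts_exp T (\<lambda>_. p) t (\<sigma> \<tau>) * v \<tau>)"
  unfolding delta_antiderivative_def
proof
  fix r assume r: "r \<in> ts_kappa T"
  have "ts_exp T (\<lambda>_. p) t (\<sigma> r) * v r = e t * (v r / e (\<sigma> r))"
    using ts_exp_eq[OF t fwd_jump_in[OF kappa_in[OF r]]] by simp
  moreover have "has_delta_derivative T (\<lambda>s. e t * V s) (e t * (v r / e (\<sigma> r))) r"
    using V r kappa_in by (intro has_delta_derivative_cmult) (simp_all add: delta_antiderivative_def)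
  ultimately show "has_delta_derivative T (\<lambda>s. e t * V s) (ts_exp T (\<lambda>_. p) t (\<sigma> r) * v r) r"
    by simp
qed

lemma convolution_integral:
  assumes "delta_antiderivative T V (\<lambda>\<tau>. v \<tau> / e (\<sigma> \<tau>))" "t \<in> T" "a \<in> T"
  shows "delta_integral T a t (\<lambda>\<tau>. ts_exp T (\<lambda>_. p) t (\<sigma> \<tau>) * v \<tau>) = e t * (V t - V a)"
  using delta_integral_eq[OF convolution_antiderivative[OF assms(1,2)] assms(3,2)]
  by (simp add: right_diff_distrib)

lemma convolution_antiderivative_exists:
  assumes "continuous_on T v" "a \<in> T"
  obtains V where "delta_antiderivative T V (\<lambda>\<tau>. v \<tau> / e (\<sigma> \<tau>))" "V a = 0"
proof -
  have "continuous_on T (\<lambda>t. 1 / e t)"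
    using exp_continuous exp_nonzero by (intro continuous_intros) auto
  from delta_integrable_mult_jump[OF assms(1) this]
  obtain V where V: "delta_antiderivative T V (\<lambda>\<tau>. v \<tau> / e (\<sigma> \<tau>))"
    by (auto simp: delta_integrable_def)
  have "delta_antiderivative T (\<lambda>s. V s - V a) (\<lambda>\<tau>. v \<tau> / e (\<sigma> \<tau>))"
    unfolding delta_antiderivative_def
  proof
    fix r assume r: "r \<in> ts_kappa T"
    then have "has_delta_derivative T V (v r / e (\<sigma> r)) r" using V by (simp add: delta_antiderivative_def)
    from has_delta_derivative_diff[OF this has_delta_derivative_const[of r "V a"]] kappa_in[OF r]
    show "has_delta_derivative T (\<lambda>s. V s - V a) (v r / e (\<sigma> r)) r" by simp
  qed
  then show ?thesis using that by force
qed

lemma variation_of_constants: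
  assumes z: "\<And>t. t \<in> ts_kappa T \<Longrightarrow> has_delta_derivative T z (p * z t + c * v t) t"
    and V: "delta_antiderivative T V (\<lambda>\<tau>. v \<tau> / e (\<sigma> \<tau>))"
    and t: "t \<in> T" and a: "a \<in> T"
  shows "z t = e t * (z a / e a + c * (V t - V a))"
proof -
  have "has_delta_derivative T (\<lambda>s. z s / e s - c * V s) 0 r" if r: "r \<in> ts_kappa T" for r
  proof -
    have "has_delta_derivative T V (v r / e (\<sigma> r)) r"
      using V r by (simp add: delta_antiderivative_def)
    from has_delta_derivative_diff[OF has_delta_derivative_div_exp[OF z[OF r] r]
        has_delta_derivative_cmult[OF this, of c]]
    show ?thesis using kappa_in[OF r] by simp
  qed
  from zero_delta_derivative_const[OF this t a]
  have "z t / e t = z a / e a + c * (V t - V a)" by (simp add: algebra_simps)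
  then show ?thesis using exp_nonzero[OF t] by (simp add: field_simps)
qed

subsection \<open>The Caputo--Fabrizio derivative as an initial value problem\<close>

lemma cf_integrand_eq:
  assumes "p = cf_rate \<alpha>" "t \<in> T" "\<tau> \<in> T"
  shows "cf_integrand T \<alpha> f t \<tau> = e t * (delta_deriv T f \<tau> / e (\<sigma> \<tau>))"
  using ts_exp_eq[OF assms(2) fwd_jump_in[OF assms(3)]] assms(1) by (simp add: cf_integrand_def)

text \<open>On \<open>ts_kappa\<close> the integrands for different \<open>t\<close> are multiples
  of one function. An antiderivative for \<open>t = 0\<close>, divided by \<open>e 0\<close>,
  therefore gives all of them, and multiplying its increment from 0 by \<open>e\<close> produces the
  solution \<open>m\<close> of the initial value problem.\<close>

lemma cf_differentiable_imp:
  assumes p: "p = cf_rate \<alpha>" and "0 \<in> T" and f: "cf_differentiable T \<alpha> f" and nt: "\<And>t. T \<noteq> {t}"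
  obtains m f' where
    "\<And>t. t \<in> ts_kappa T \<Longrightarrow> has_delta_derivative T f (f' t) t"
    "\<And>t. t \<in> ts_kappa T \<Longrightarrow> has_delta_derivative T m (p * m t + f' t) t"
    "m 0 = 0"
    "\<And>t. t \<in> T \<Longrightarrow> cf_deriv T \<alpha> f t = m t / (1 - \<alpha>)"
proof -
  let ?f' = "delta_deriv T f"
  have f': "has_delta_derivative T f (?f' t) t" if "t \<in> ts_kappa T" for t
    using f that delta_deriv_eq[OF _ that nt]
    by (metis cf_differentiable_def delta_differentiable_def)
  obtain W0 where W0: "delta_antiderivative T W0 (cf_integrand T \<alpha> f 0)"
    using f \<open>0 \<in> T\<close> by (auto simp: cf_differentiable_def delta_integrable_def)
  define W where "W t = W0 t / e 0" for t
  have W: "has_delta_derivative T W (?f' t / e (\<sigma> t)) t" if t: "t \<in> ts_kappa T" for t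
  proof -
    have "has_delta_derivative T W0 (cf_integrand T \<alpha> f 0 t) t"
      using W0 t by (simp add: delta_antiderivative_def)
    then have "has_delta_derivative T W0 (e 0 * (?f' t / e (\<sigma> t))) t"
      by (simp only: cf_integrand_eq[OF p \<open>0 \<in> T\<close> kappa_in[OF t]])
    from has_delta_derivative_cmult[OF this kappa_in[OF t], of "1 / e 0"] show ?thesis
      using exp_nonzero[OF \<open>0 \<in> T\<close>] by (simp add: W_def[abs_def])
  qed
  define m where "m t = e t * (W t - W 0)" for t
  show ?thesis
  proof (rule that[of ?f' m])
    fix t assume t: "t \<in> ts_kappa T"
    have "has_delta_derivative T (\<lambda>s. W s - W 0) (?f' t / e (\<sigma> t)) t"
      using has_delta_derivative_diff[OF W[OF t] has_delta_derivative_const] kappa_in[OF t] by simp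
    from has_delta_derivative_exp_mult[OF this t]
    show "has_delta_derivative T m (p * m t + ?f' t) t" by (simp add: m_def[abs_def])
  next
    fix t assume t: "t \<in> T"
    have "delta_antiderivative T (\<lambda>s. e t * W s) (cf_integrand T \<alpha> f t)"
      unfolding delta_antiderivative_def
    proof
      fix r assume r: "r \<in> ts_kappa T"
      from has_delta_derivative_cmult[OF W[OF r] kappa_in[OF r], of "e t"]
      show "has_delta_derivative T (\<lambda>s. e t * W s) (cf_integrand T \<alpha> f t r) r"
        by (simp only: cf_integrand_eq[OF p t kappa_in[OF r]])
    qed
    from delta_integral_eq[OF this \<open>0 \<in> T\<close> t]
    show "cf_deriv T \<alpha> f t = m t / (1 - \<alpha>)"
      by (simp add: cf_deriv_def m_def right_diff_distrib diff_divide_distrib)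
  qed (use f' in \<open>auto simp: m_def\<close>)
qed

text \<open>Conversely, \<open>m / e\<close> is an antiderivative of the separated integrand. It
  supplies both the integrability demanded by \<open>cf_differentiable\<close> and the value of the
  integral, with \<open>m 0 = 0\<close> removing the lower endpoint.\<close>

lemma cf_differentiableI:
  assumes p: "p = cf_rate \<alpha>" and "0 \<in> T" and nt: "\<And>t. T \<noteq> {t}"
    and f: "\<And>t. t \<in> ts_kappa T \<Longrightarrow> has_delta_derivative T f (f' t) t"
    and m: "\<And>t. t \<in> ts_kappa T \<Longrightarrow> has_delta_derivative T m (p * m t + f' t) t"
    and "m 0 = 0"
  shows "cf_differentiable T \<alpha> f" and "t \<in> T \<Longrightarrow> cf_deriv T \<alpha> f t = m t / (1 - \<alpha>)"
proof -
  have A: "delta_antiderivative T (\<lambda>s. e t * (m s / e s)) (cf_integrand T \<alpha> f t)" if t: "t \<in> T" for t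
    unfolding delta_antiderivative_def
  proof
    fix r assume r: "r \<in> ts_kappa T"
    have "has_delta_derivative T (\<lambda>s. m s / e s) (f' r / e (\<sigma> r)) r"
      using has_delta_derivative_div_exp[OF m[OF r] r] by simp
    from has_delta_derivative_cmult[OF this kappa_in[OF r], of "e t"]
    show "has_delta_derivative T (\<lambda>s. e t * (m s / e s)) (cf_integrand T \<alpha> f t r) r"
      using cf_integrand_eq[OF p t kappa_in[OF r]] delta_deriv_eq[OF f[OF r] r nt] by simp
  qed
  show "cf_differentiable T \<alpha> f"
    using f A by (auto simp: cf_differentiable_def delta_differentiable_def delta_integrable_def)
  show "cf_deriv T \<alpha> f t = m t / (1 - \<alpha>)" if t: "t \<in> T"
    using delta_integral_eq[OF A[OF t] \<open>0 \<in> T\<close> t] exp_nonzero[OF t] \<open>m 0 = 0\<close>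
    by (simp add: cf_deriv_def)
qed

end

text \<open>At \<open>t = 0\<close> the integral vanishes and the equation reads
  \<open>0 = lam * x0 + u 0\<close>. Initial value and input must therefore be compatible, which is
  why existence takes the form of an equivalence while uniqueness is unconditional.\<close>

theorem theorem3p9:
  fixes T :: "real set" and \<alpha> lam x0 K p :: real and u \<phi> :: "real \<Rightarrow> real"
  assumes "0 \<le> \<alpha>" and "\<alpha> < 1"
    and "time_scale T" and "\<not> bounded T" and "0 \<in> T"
    and "K = 1 - lam * (1 - \<alpha>)" and "K \<noteq> 0"
    and "p = lam * \<alpha> / K"
    and "regressive T (\<lambda>_. cf_rate \<alpha>)" and "regressive T (\<lambda>_. p)"
    and "\<phi> = (\<lambda>t. x0 - 1 / K * (1 - ts_exp T (\<lambda>_. p) t 0) * x0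
              + (1 - \<alpha>) / K * (u t - u 0)
              + \<alpha> / K\<^sup>2 * delta_integral T 0 t (\<lambda>\<tau>. ts_exp T (\<lambda>_. p) t (fwd_jump T \<tau>) * u \<tau>))"
  shows "(\<forall>x. cf_solution T \<alpha> lam u x0 x \<longrightarrow> (\<forall>t\<in>T. x t = \<phi> t))
       \<and> (cf_solution T \<alpha> lam u x0 \<phi> \<longleftrightarrow> delta_differentiable T u \<and> lam * x0 + u 0 = 0)"
proof -
  interpret timescale T by unfold_locales fact
  have T0: "0 \<in> T" by fact
  \<comment> \<open>Unboundedness rules out a one-point time scale, where delta derivatives would
    not be unique.\<close>
  have nt: "T \<noteq> {t}" for t using \<open>\<not> bounded T\<close> by auto
  have a1: "1 - \<alpha> \<noteq> 0" using \<open>\<alpha> < 1\<close> by simp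
  define q where "q = cf_rate \<alpha>"
  have q: "q = - \<alpha> / (1 - \<alpha>)" using \<open>\<alpha> < 1\<close> by (simp add: q_def cf_rate_def field_simps)
  have "regressive T (\<lambda>_. q)" using assms(9) by (simp only: q_def)
  from nonvanishing_exponential_exists[OF this T0]
  obtain d where "\<forall>t\<in>ts_kappa T. has_delta_derivative T d (q * d t) t" "\<forall>t\<in>T. d t \<noteq> 0"
    by blast
  then interpret Q: timescale_exp T q d by unfold_locales auto
  from nonvanishing_exponential_exists[OF assms(10) T0]
  obtain e where "\<forall>t\<in>ts_kappa T. has_delta_derivative T e (p * e t) t" "\<forall>t\<in>T. e t \<noteq> 0"
    and e0: "e 0 = 1"
    by blast
  then interpret P: timescale_exp T p e by unfold_locales auto
  have K: "lam * (1 - \<alpha>) = 1 - K" by (simp add: assms(6))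
  have \<phi>: "\<phi> t = x0 - 1 / K * (1 - e t) * x0 + (1 - \<alpha>) / K * (u t - u 0) + \<alpha> / K\<^sup>2 * (e t * V t)"
    if "delta_antiderivative T V (\<lambda>\<tau>. u \<tau> / e (\<sigma> \<tau>))" "V 0 = 0" "t \<in> T" for V t
    using P.ts_exp_eq[OF that(3) T0] P.convolution_integral[OF that(1,3) T0] that(2) e0
    by (simp add: assms(11))
  \<comment> \<open>The left side is the shape of the stated formula, the right side the shape that
    variation of constants delivers. Compatibility reconciles them, since it turns
    \<open>c * u 0\<close> into \<open>x0 - x0 / K\<close>.\<close>
  have initial: "x0 - 1 / K * (1 - E) * x0 + c * (ut - u 0) + I
      = c * ut + E * (x0 - c * u 0) + I" if "c = (1 - \<alpha>) / K" "lam * x0 + u 0 = 0" for E ut I c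
  proof -
    have u0: "u 0 = - lam * x0" using that by simp
    have "c * lam = (1 - K) / K" using K that(1) by (simp add: mult.commute)
    have "c * u 0 = - (c * lam) * x0" by (simp add: u0)
    also have "\<dots> = x0 - x0 / K" unfolding \<open>c * lam = (1 - K) / K\<close>
      using \<open>K \<noteq> 0\<close> by (simp add: field_simps)
    finally have cu: "c * u 0 = x0 - x0 / K" .
    show ?thesis unfolding right_diff_distrib cu by (simp add: algebra_simps diff_divide_distrib)
  qed
  define c where "c = (1 - \<alpha>) / K"
  have sol: "delta_differentiable T u \<and> lam * x0 + u 0 = 0 \<and> (\<forall>t\<in>T. x t = \<phi> t)"
    if x: "cf_solution T \<alpha> lam u x0 x" for x
  proof -
    have "cf_differentiable T \<alpha> x" using x by (simp add: cf_solution_def)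
    then obtain m x' where
      x': "\<And>t. t \<in> ts_kappa T \<Longrightarrow> has_delta_derivative T x (x' t) t" and
      m': "\<And>t. t \<in> ts_kappa T \<Longrightarrow> has_delta_derivative T m (q * m t + x' t) t" and
      m0: "m 0 = 0" and cf: "\<And>t. t \<in> T \<Longrightarrow> cf_deriv T \<alpha> x t = m t / (1 - \<alpha>)"
      using Q.cf_differentiable_imp[OF q_def T0 _ nt] by metis
    have eq: "m t / (1 - \<alpha>) = lam * x t + u t" if "t \<in> T" for t
      using x cf that by (simp add: cf_solution_def)
    have x0: "x 0 = x0" using x by (simp add: cf_solution_def)
    \<comment> \<open>On \<open>T\<close> the input is a linear combination of the differentiable
      functions \<open>m\<close> and \<open>x\<close>; this is the source of its
      differentiability.\<close>
    have u: "u t = 1 / (1 - \<alpha>) * m t - lam * x t" if "t \<in> T" for t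
      using eq[OF that] by (simp add: field_simps)
    have m: "m t = (1 - \<alpha>) * (lam * x t + u t)" if "t \<in> T" for t
      using eq[OF that] a1 by (simp add: field_simps)
    define u' where "u' t = 1 / (1 - \<alpha>) * (q * m t + x' t) - lam * x' t" for t
    have u': "has_delta_derivative T u (u' t) t" if t: "t \<in> ts_kappa T" for t
    proof -
      have "has_delta_derivative T (\<lambda>s. 1 / (1 - \<alpha>) * m s - lam * x s) (u' t) t"
        unfolding u'_def using m' x' t kappa_in
        by (intro has_delta_derivative_diff has_delta_derivative_cmult) auto
      then show ?thesis using has_delta_derivative_cong[OF u kappa_in[OF t]] by simp
    qed
    have comp: "lam * x0 + u 0 = 0" using eq[OF T0] m0 x0 by simp
    define z where "z t = x t - c * u t" for t
    have z': "has_delta_derivative T z (p * z t + \<alpha> / K\<^sup>2 * u t) t" if t: "t \<in> ts_kappa T" for t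
    proof -
      have "has_delta_derivative T z (x' t - c * u' t) t"
        unfolding z_def[abs_def] using u' x' t kappa_in
        by (intro has_delta_derivative_diff has_delta_derivative_cmult) auto
      moreover have "x' t - c * u' t = p * z t + \<alpha> / K\<^sup>2 * u t"
      proof -
        have "(1 - \<alpha>) * u' t = (1 - lam * (1 - \<alpha>)) * x' t + q * m t"
          using a1 by (simp add: u'_def field_simps)
        also have "q * m t = - \<alpha> * (lam * x t + u t)"
          using m[OF kappa_in[OF t]] q a1 by simp
        finally have "c * u' t = x' t - \<alpha> * (lam * x t + u t) / K"
          using \<open>K \<noteq> 0\<close> K by (simp add: c_def field_simps)
        moreover have "p * z t + \<alpha> / K\<^sup>2 * u t = \<alpha> * (lam * x t + u t) / K"
        proof -
          \<comment> \<open>The factor \<open>1 - lam * (1 - \<alpha>)\<close> is \<open>K\<close>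
            and cancels one power of \<open>K\<close> in the denominator.\<close>
          have "p * z t + \<alpha> / K\<^sup>2 * u t = p * x t + \<alpha> * (1 - lam * (1 - \<alpha>)) / K\<^sup>2 * u t"
            by (simp add: assms(8) z_def c_def power2_eq_square diff_divide_distrib add_divide_distrib algebra_simps)
          also have "\<dots> = \<alpha> * (lam * x t + u t) / K"
            unfolding K using \<open>K \<noteq> 0\<close> by (simp add: assms(8) power2_eq_square field_simps)
          finally show ?thesis .
        qed
        ultimately show ?thesis by simp
      qed
      ultimately show ?thesis by simp
    qed
    have "continuous_on T u" using u' by (rule delta_differentiable_continuous_on)
    from P.convolution_antiderivative_exists[OF this T0]
    obtain V where V: "delta_antiderivative T V (\<lambda>\<tau>. u \<tau> / e (\<sigma> \<tau>))" "V 0 = 0" .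
    have "x t = \<phi> t" if t: "t \<in> T" for t
    proof -
      have "z t = e t * (x0 - c * u 0 + \<alpha> / K\<^sup>2 * V t)"
        using P.variation_of_constants[OF z' V(1) t T0] V(2) e0 x0 by (simp add: z_def)
      then have "x t = c * u t + e t * (x0 - c * u 0) + \<alpha> / K\<^sup>2 * (e t * V t)"
        by (simp add: z_def algebra_simps)
      also have "\<dots> = \<phi> t"
        using \<phi>[OF V t] initial[OF c_def comp] by (simp add: c_def)
      finally show ?thesis .
    qed
    moreover have "delta_differentiable T u" using u' by (auto simp: delta_differentiable_def)
    ultimately show ?thesis using comp by simp
  qed
  have "cf_solution T \<alpha> lam u x0 \<phi>" if du: "delta_differentiable T u" and comp: "lam * x0 + u 0 = 0"
  proof -
    obtain u' where u': "\<And>t. t \<in> ts_kappa T \<Longrightarrow> has_delta_derivative T u (u' t) t"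
      using du unfolding delta_differentiable_def by metis
    have "continuous_on T u" using u' by (rule delta_differentiable_continuous_on)
    from P.convolution_antiderivative_exists[OF this T0]
    obtain V where V: "delta_antiderivative T V (\<lambda>\<tau>. u \<tau> / e (\<sigma> \<tau>))" "V 0 = 0" .
    define z where "z t = e t * (x0 - c * u 0 + \<alpha> / K\<^sup>2 * V t)" for t
    have \<phi>z: "\<phi> t = z t + c * u t" if t: "t \<in> T" for t
    proof -
      have "\<phi> t = c * u t + e t * (x0 - c * u 0) + \<alpha> / K\<^sup>2 * (e t * V t)"
        using \<phi>[OF V t] initial[OF c_def comp] by (simp add: c_def)
      then show ?thesis by (simp add: z_def algebra_simps)
    qed
    have \<phi>0: "\<phi> 0 = x0" using \<phi>z[OF T0] e0 V by (simp add: z_def)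
    \<comment> \<open>Written through \<open>\<phi>\<close> instead of \<open>z\<close>, the
      derivative satisfies \<open>K * z' t = - q * m t\<close> for the \<open>m\<close> introduced
      below, which is what its differential equation needs.\<close>
    define z' where "z' t = \<alpha> * (lam * \<phi> t + u t) / K" for t
    have z': "has_delta_derivative T z (z' t) t" if t: "t \<in> ts_kappa T" for t
    proof -
      have "has_delta_derivative T V (u t / e (\<sigma> t)) t"
        using V t by (simp add: delta_antiderivative_def)
      from has_delta_derivative_add[OF has_delta_derivative_const
          has_delta_derivative_cmult[OF this kappa_in[OF t], of "\<alpha> / K\<^sup>2"], of "x0 - c * u 0"]
      have "has_delta_derivative T (\<lambda>s. x0 - c * u 0 + \<alpha> / K\<^sup>2 * V s) ((\<alpha> / K\<^sup>2 * u t) / e (\<sigma> t)) t"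
        using kappa_in[OF t] by simp
      from P.has_delta_derivative_exp_mult[OF this t]
      have "has_delta_derivative T z (p * z t + \<alpha> / K\<^sup>2 * u t) t" by (simp add: z_def[abs_def])
      moreover have "p * z t + \<alpha> / K\<^sup>2 * u t = z' t"
      proof -
        have zt: "z t = \<phi> t - c * u t" using \<phi>z[OF kappa_in[OF t]] by simp
        have "p * z t + \<alpha> / K\<^sup>2 * u t = p * \<phi> t + \<alpha> * (1 - lam * (1 - \<alpha>)) / K\<^sup>2 * u t"
          unfolding zt
          by (simp add: assms(8) c_def power2_eq_square diff_divide_distrib add_divide_distrib algebra_simps)
        also have "\<dots> = z' t"
          unfolding K using \<open>K \<noteq> 0\<close> by (simp add: assms(8) z'_def power2_eq_square field_simps)
        finally show ?thesis .
      qed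
      ultimately show ?thesis by simp
    qed
    define \<phi>' where "\<phi>' t = z' t + c * u' t" for t
    have \<phi>': "has_delta_derivative T \<phi> (\<phi>' t) t" if t: "t \<in> ts_kappa T" for t
    proof -
      have "has_delta_derivative T (\<lambda>s. z s + c * u s) (\<phi>' t) t"
        unfolding \<phi>'_def using u' z' t kappa_in
        by (intro has_delta_derivative_add has_delta_derivative_cmult) auto
      then show ?thesis using has_delta_derivative_cong[OF \<phi>z kappa_in[OF t]] by simp
    qed
    \<comment> \<open>The equation to be proved dictates this candidate for the rescaled fractional
      derivative of \<open>\<phi>\<close>; it remains to see that it solves the initial value
      problem, where \<open>m 0 = 0\<close> is the compatibility condition.\<close>
    define m where "m t = (1 - \<alpha>) * (lam * \<phi> t + u t)" for t
    have m': "has_delta_derivative T m (q * m t + \<phi>' t) t" if t: "t \<in> ts_kappa T" for t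
    proof -
      have "has_delta_derivative T m ((1 - \<alpha>) * (lam * \<phi>' t + u' t)) t"
        unfolding m_def[abs_def] using u' \<phi>' t kappa_in
        by (intro has_delta_derivative_add has_delta_derivative_cmult) auto
      moreover have "(1 - \<alpha>) * (lam * \<phi>' t + u' t) = q * m t + \<phi>' t"
      proof -
        have "q * m t = - (K * z' t)" using q a1 \<open>K \<noteq> 0\<close> by (simp add: m_def z'_def)
        moreover have "(1 - \<alpha>) * u' t = K * (\<phi>' t - z' t)"
          using \<open>K \<noteq> 0\<close> by (simp add: \<phi>'_def c_def)
        moreover have "(1 - \<alpha>) * (lam * \<phi>' t) = (1 - K) * \<phi>' t" 
          using K by (simp only: mult.assoc[symmetric] mult.commute[of "1 - \<alpha>" lam])
        ultimately show ?thesis by (simp add: algebra_simps)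
      qed
      ultimately show ?thesis by simp
    qed
    have m0: "m 0 = 0" using comp \<phi>0 by (simp add: m_def)
    note cf = Q.cf_differentiableI[OF q_def T0 nt \<phi>' m' m0]
    show ?thesis unfolding cf_solution_def
      using cf \<phi>0 a1 by (simp add: m_def)
  qed
  then show ?thesis using sol by blast
qed

end
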